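(* Let $G$ be a finite group such that $|Z(G)| = z$ and $G/Z(G) \cong D_{2n}$, where $n \ge 3$ and $D_{2n}$ is the dihedral group of order $2n$. Let $\Gamma_G$ be the commuting conjugacy class graph of $G$. (a) If $n$ is even, then (i) $\text{CNL-spec}(\Gamma_G) = \left\{ (0)^3, \left(\tfrac14 (nz - z)(nz - z - 4)\right)^{\frac12(nz - z - 2)}, \left(\tfrac14 z(z-4)\right)^{z-2} \right\}$ and $$LE_{CN}(\Gamma_G) = \frac{((n-1)z - 2)\,\bigl(n(z+1)((n-2)z - 4) + 11z - 4\bigr)}{2(n+1)};$$ (ii) $\text{CNSL-spec}(\Gamma_G) = \left\{ \left(\tfrac12(nz - z - 2)(nz - z - 4)\right)^1, \left(\tfrac14(nz - z - 4)^2\right)^{\frac12(nz - z - 2)}, \left(\tfrac12(z-2)(z-4)\right)^2, \left(\tfrac14(z-4)^2\right)^{z-2} \right\}$ and $$LE^+_{CN}(\Gamma_G) = \begin{cases} \frac{28}{5}, & \text{for } n = 4 \text{ and } z = 2,\\ \frac35 z^2(4z - 6), & \text{for } n = 4 \text{ and } z \ge 3,\\ \frac{(n-2)(n-1)z^2(nz - 6)}{2(n+1)}, & \text{otherwise.}\end{cases}$$ (b) If $n$ is odd, then (i) $\text{CNL-spec}(\Gamma_G) = \left\{ (0)^2, \left(\tfrac14(nz - z)(nz - z - 4)\right)^{\frac12(nz - z - 2)}, (z(z-2))^{z-1} \right\}$ and $$LE_{CN}(\Gamma_G) = \begin{cases} 0, & \text{for } n = 3 \text{ and } z = 1,\\ 4(z-1)(z-2),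 & \text{for } n = 3 \text{ and } z \ge 2,\\ \frac{((n-1)z - 2)\left((n-3)(n+1)z^2 + ((n-6)n + 17)z - 4(n+1)\right)}{2(n+1)}, & \text{otherwise;}\end{cases}$$ (ii) $\text{CNSL-spec}(\Gamma_G) = \left\{ \left(\tfrac12(nz - z - 2)(nz - z - 4)\right)^1, \left(\tfrac14(nz - z - 4)^2\right)^{\frac12(nz - z - 2)}, (2(z-1)(z-2))^1, ((z-2)^2)^{z-1} \right\}$ and $$LE^+_{CN}(\Gamma_G) = \begin{cases} 0, & \text{for } n = 3 \text{ and } z = 1, \text{ or } n = 5 \text{ and } z = 1,\\ 4(z-1)(z-2), & \text{for } n = 3 \text{ and } z \ge 2,\\ \frac{(n-5)(n-3)(n+3)}{2(n+1)}, & \text{for } n \ge 7 \text{ and } z = 1,\\ \frac{(n-3)(n-1)z^2(nz + z - 6)}{2(n+1)}, & \text{otherwise.}\end{cases}$$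
   Context: For a finite non-abelian group $G$ with center $Z(G)$, the commuting conjugacy class graph (CCC-graph) $\Gamma_G$ is the simple undirected graph whose vertices are the conjugacy classes $x^G$ of non-central elements $x \in G \setminus Z(G)$; two distinct vertices $x^G, y^G$ are adjacent if there exist $x' \in x^G$ and $y' \in y^G$ with $x'y' = y'x'$. For a finite simple graph $\mathcal{G}$ with vertices $v_1,\dots,v_N$, let $CN(\mathcal{G})$ be the $N\times N$ matrix whose $(i,j)$ entry is, for $i\ne j$, the number of vertices other than $v_i,v_j$ adjacent to both $v_i$ and $v_j$, and whose diagonal entries are $0$. Let $CNRS(\mathcal{G})$ be the diagonal matrix whose $i$-th diagonal entry is the $i$-th row sum of $CN(\mathcal{G})$. Put $CNL(\mathcal{G}) = CNRS(\mathcal{G}) - CN(\mathcal{G})$ and $CNSL(\mathcal{G}) = CNRS(\mathcal{G}) + CN(\mathcal{G})$. CNL-spec$(\mathcal{G})$ and CNSL-spec$(\mathcal{G})$ denote the multisets of eigenvalues of $CNL(\mathcal{G})$ and $CNSL(\mathcal{G})$; $(\alpha)^a$ means eigenvalue $\alpha$ with multiplicity $a$ (an entry with multiplicity $0$ is absent; multiplicities of listed entries with coinciding values are added). Let $\Delta(\mathcal{G}) = \operatorname{tr}(CNRS(\mathcal{G}))/N$. Then $LE_{CN}(\mathcal{G}) = \sum_{\alpha} |\alpha - \Delta(\mathcal{G})|$ over all eigenvalues $\alpha$ of $CNL(\mathcal{G})$ counted with multiplicity, and $LE^+_{CN}(\mathcal{G}) = \sum_{\beta} |\beta - \Delta(\mathcal{G})|$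 over all eigenvalues $\beta$ of $CNSL(\mathcal{G})$ counted with multiplicity. *)

theory Defs
  imports
    "HOL-Algebra.Coset"
    "Jordan_Normal_Form.Char_Poly"
    "Graph_Theory.Pair_Digraph"
begin

section \<open>Center, conjugacy classes, dihedral groups\<close>

definition center :: "('a, 'b) monoid_scheme \<Rightarrow> 'a set" where
  "center G = {z \<in> carrier G. \<forall>x \<in> carrier G. z \<otimes>\<^bsub>G\<^esub> x = x \<otimes>\<^bsub>G\<^esub> z}"

definition conj_class :: "('a, 'b) monoid_scheme \<Rightarrow> 'a \<Rightarrow> 'a set" where
  "conj_class G x = {g \<otimes>\<^bsub>G\<^esub> x \<otimes>\<^bsub>G\<^esub> inv\<^bsub>G\<^esub> g | g. g \<in> carrier G}"

text \<open>The dihedral group of order \<open>2 n\<close> (\<open>n \<ge> 1\<close>). The pair \<open>(i, e)\<close> stands for \<open>r\<^sup>i s\<^sup>e\<close>,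
  where \<open>r\<close> is the rotation of order \<open>n\<close>, \<open>s\<close> a reflection, and \<open>s r s = r\<^sup>-\<^sup>1\<close>.\<close>

definition dihedral :: "nat \<Rightarrow> (int \<times> bool) monoid" where
  "dihedral n =
    \<lparr> carrier = {0..<int n} \<times> UNIV,
      monoid.mult = (\<lambda>(i, e) (j, f). ((if e then i - j else i + j) mod int n, e \<noteq> f)),
      monoid.one = (0, False) \<rparr>"

lemma group_dihedral:
  assumes "n \<ge> 1"
  shows "group (dihedral n)"
proof (rule groupI)
  fix x y assume "x \<in> carrier (dihedral n)" "y \<in> carrier (dihedral n)"
  then show "x \<otimes>\<^bsub>dihedral n\<^esub> y \<in> carrier (dihedral n)"
    using assms by (auto simp: dihedral_def split: prod.splits)
next
  show "\<one>\<^bsub>dihedral n\<^esub> \<in> carrier (dihedral n)"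
    using assms by (auto simp: dihedral_def)
next
  fix x y z
  show "x \<otimes>\<^bsub>dihedral n\<^esub> y \<otimes>\<^bsub>dihedral n\<^esub> z = x \<otimes>\<^bsub>dihedral n\<^esub> (y \<otimes>\<^bsub>dihedral n\<^esub> z)"
    by (cases x; cases y; cases z)
      (auto simp: dihedral_def mod_simps algebra_simps)
next
  fix x assume "x \<in> carrier (dihedral n)"
  then show "\<one>\<^bsub>dihedral n\<^esub> \<otimes>\<^bsub>dihedral n\<^esub> x = x"
    by (auto simp: dihedral_def)
next
  fix x assume x: "x \<in> carrier (dihedral n)"
  obtain i e where [simp]: "x = (i, e)" by (cases x)
  show "\<exists>y \<in> carrier (dihedral n). y \<otimes>\<^bsub>dihedral n\<^esub> x = \<one>\<^bsub>dihedral n\<^esub>"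
  proof (rule bexI)
    show "(if e then i else (- i) mod int n, e) \<otimes>\<^bsub>dihedral n\<^esub> x = \<one>\<^bsub>dihedral n\<^esub>"
      by (auto simp: dihedral_def mod_simps)
    show "(if e then i else (- i) mod int n, e) \<in> carrier (dihedral n)"
      using x assms by (auto simp: dihedral_def)
  qed
qed

lemma order_dihedral: "Coset.order (dihedral n) = 2 * n"
  by (simp add: Coset.order_def dihedral_def card_cartesian_product)

lemma dihedral_rotation_power:
  assumes "n \<ge> 2"
  shows "(1, False) [^]\<^bsub>dihedral n\<^esub> (k :: nat) = (int k mod int n, False)"
proof -
  interpret group "dihedral n" using assms by (intro group_dihedral) simp
  show ?thesis
    by (induction k) (auto simp: nat_pow_def dihedral_def mod_simps algebra_simps)
qed

lemma dihedral_relations: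
  assumes "n \<ge> 2"
  shows "(0, True) \<otimes>\<^bsub>dihedral n\<^esub> (0, True) = \<one>\<^bsub>dihedral n\<^esub>"
    and "(0, True) \<otimes>\<^bsub>dihedral n\<^esub> (1, False) \<otimes>\<^bsub>dihedral n\<^esub> (0, True) \<otimes>\<^bsub>dihedral n\<^esub> (1, False)
      = \<one>\<^bsub>dihedral n\<^esub>"
  using assms by (auto simp: dihedral_def mod_simps)

section \<open>The commuting conjugacy class graph\<close>

text \<open>Simple undirected graphs are represented as in the library locale \<open>pair_graph\<close>: loop-free
  symmetric digraphs, an edge being a pair of opposite arcs.\<close>

definition ccc_graph :: "('a, 'b) monoid_scheme \<Rightarrow> 'a set pair_pre_digraph" where
  "ccc_graph G =
    \<lparr> pverts = conj_class G ` (carrier G - center G),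
      parcs = {(X, Y). X \<in> conj_class G ` (carrier G - center G) \<and>
                       Y \<in> conj_class G ` (carrier G - center G) \<and> X \<noteq> Y \<and>
                       (\<exists>x' \<in> X. \<exists>y' \<in> Y. x' \<otimes>\<^bsub>G\<^esub> y' = y' \<otimes>\<^bsub>G\<^esub> x')} \<rparr>"

lemma pair_graph_ccc_graph:
  assumes "finite (carrier G)"
  shows "pair_graph (ccc_graph G)"
proof -
  let ?V = "conj_class G ` (carrier G - center G)"
  have fin: "finite ?V" using assms by simp
  have "parcs (ccc_graph G) \<subseteq> ?V \<times> ?V" by (auto simp: ccc_graph_def)
  then have "finite (parcs (ccc_graph G))" by (rule finite_subset) (use fin in simp)
  moreover have "symmetric (with_proj (ccc_graph G))"
    unfolding symmetric_def by (auto simp: ccc_graph_def intro!: symI) metis+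
  ultimately show ?thesis
    using fin by unfold_locales (auto simp: ccc_graph_def)
qed

section \<open>Common neighbourhood (signless) Laplacian\<close>

text \<open>The list \<open>vs\<close> is an enumeration \<open>v\<^sub>1, \<dots>, v\<^sub>N\<close> of the vertices of \<open>\<G>\<close>; rows and columns are
  indexed from \<open>0\<close>.\<close>

definition CN :: "'v pair_pre_digraph \<Rightarrow> 'v list \<Rightarrow> real mat" where
  "CN \<G> vs = mat (length vs) (length vs) (\<lambda>(i, j).
     if i = j then 0
     else real (card {w \<in> pverts \<G> - {vs ! i, vs ! j}.
                        (vs ! i, w) \<in> parcs \<G> \<and> (vs ! j, w) \<in> parcs \<G>}))"

definition CNRS :: "'v pair_pre_digraph \<Rightarrow> 'v list \<Rightarrow> real mat" where
  "CNRS \<G> vs = mat_diag (length vs) (\<lambda>i. \<Sum>j<length vs. CN \<G> vs $$ (i, j))"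

definition CNL :: "'v pair_pre_digraph \<Rightarrow> 'v list \<Rightarrow> real mat" where
  "CNL \<G> vs = CNRS \<G> vs - CN \<G> vs"

definition CNSL :: "'v pair_pre_digraph \<Rightarrow> 'v list \<Rightarrow> real mat" where
  "CNSL \<G> vs = CNRS \<G> vs + CN \<G> vs"

text \<open>The eigenvalues with their algebraic multiplicities. Only real eigenvalues are collected;
  the matrices \<open>CNL\<close> and \<open>CNSL\<close> of an undirected graph are real symmetric, so these are all of them.\<close>

definition spec :: "real mat \<Rightarrow> real multiset" where
  "spec A = proots (char_poly A)"

lemma set_mset_spec:
  assumes "A \<in> carrier_mat n n"
  shows "set_mset (spec A) = {k. eigenvalue A k}"
proof -
  have "char_poly A \<noteq> 0" using degree_monic_char_poly[OF assms] by auto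
  then show ?thesis by (simp add: spec_def eigenvalue_root_char_poly[OF assms])
qed

definition CNL_spec :: "'v pair_pre_digraph \<Rightarrow> 'v list \<Rightarrow> real multiset" where
  "CNL_spec \<G> vs = spec (CNL \<G> vs)"

definition CNSL_spec :: "'v pair_pre_digraph \<Rightarrow> 'v list \<Rightarrow> real multiset" where
  "CNSL_spec \<G> vs = spec (CNSL \<G> vs)"

text \<open>The average \<open>tr (CNRS \<G>) / N\<close>.\<close>

definition CN_Delta :: "'v pair_pre_digraph \<Rightarrow> 'v list \<Rightarrow> real" where
  "CN_Delta \<G> vs = (\<Sum>i<length vs. CNRS \<G> vs $$ (i, i)) / real (length vs)"

definition LE_CN :: "'v pair_pre_digraph \<Rightarrow> 'v list \<Rightarrow> real" where
  "LE_CN \<G> vs = (\<Sum>\<alpha>\<in>#CNL_spec \<G> vs. \<bar>\<alpha> - CN_Delta \<G> vs\<bar>)"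

definition LE_plus_CN :: "'v pair_pre_digraph \<Rightarrow> 'v list \<Rightarrow> real" where
  "LE_plus_CN \<G> vs = (\<Sum>\<beta>\<in>#CNSL_spec \<G> vs. \<bar>\<beta> - CN_Delta \<G> vs\<bar>)"

end

theory Submission
  imports Defs
begin

text \<open>An element of the preimage of the rotations that commutes with an element outside it is central,
  because that preimage is abelian and the outside element generates \<open>G\<close> together with it. Hence
  the classes of non-central preimages of rotations have size \<open>2\<close> and form one clique of
  \<open>(n - 1) z / 2\<close> vertices. The classes of preimages of reflections have size \<open>n\<close>, and two of them
  are adjacent iff their images in the dihedral group are conjugate: this gives one clique of \<open>z\<close>
  vertices for odd \<open>n\<close> and two cliques of \<open>z / 2\<close> vertices for even \<open>n\<close>.

  On a clique of \<open>m\<close> vertices the two matrices are \<open>(m - 2) (m I - J)\<close> and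
  \<open>(m - 2) ((m - 2) I + J)\<close>, where \<open>J\<close> is the all-ones matrix, which gives the spectra. For the
  energies, \<open>\<Delta>\<close> is the mean of \<open>(m - 1) (m - 2)\<close> over the cliques weighted by \<open>m\<close>, so it lies
  between the values for the small and the large cliques; this settles almost all signs of
  \<open>\<alpha> - \<Delta>\<close>.\<close>

section \<open>Block matrices\<close>

text \<open>With \<open>J\<close> the all-ones matrix, this is \<open>p I + q J\<close> on each
  fibre of \<open>b\<close> and zero elsewhere. The coefficients may vary with the fibre, and fibres
  need not be intervals of indices.\<close>

definition block_mat :: "nat \<Rightarrow> (nat \<Rightarrow> 'b) \<Rightarrow> ('b \<Rightarrow> real) \<Rightarrow> ('b \<Rightarrow> real) \<Rightarrow> real mat" where
  "block_mat N b p q = mat N N (\<lambda>(i, j).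
     if b i = b j then (if i = j then p (b i) else 0) + q (b i) else 0)"

context
  fixes N :: nat and b :: "nat \<Rightarrow> 'b"
begin

private definition block :: "'b \<Rightarrow> nat set" where
  "block c = {k. k < N \<and> b k = c}"

text \<open>The minimum is over all natural numbers; it is at most \<open>i\<close>, so it stays
  below \<open>N\<close> whenever \<open>i\<close> does.\<close>

private definition rep :: "nat \<Rightarrow> nat" where
  "rep i = (LEAST k. b k = b i)"

text \<open>This eigenbasis is written down for an arbitrary order of the indices, so the matrix need not
  be permuted into block diagonal form.\<close>

private definition eigvecs :: "real mat" where
  "eigvecs = mat N N (\<lambda>(i, j). if b i = b j
     then (if rep j = j then 1 else of_bool (i = j) - of_bool (i = rep j)) else 0)"

text \<open>Coordinates in the eigenbasis: on a block where \<open>x\<close> has mean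
  \<open>\<mu>\<close>, the vector \<open>x\<close> is \<open>\<mu>\<close> times the all-ones
  vector plus the sum of \<open>(x i - \<mu>) (e i - e (rep i))\<close>. So the row of a
  representative takes the mean and any other row the deviation from it.\<close>

private definition eigvecs_inv :: "real mat" where
  "eigvecs_inv = mat N N (\<lambda>(i, j). if b i = b j
     then of_bool (rep i \<noteq> i \<and> i = j) + (if rep i = i then 1 else - 1) / card (block (b i)) else 0)"

private lemma b_rep: "b (rep i) = b i"
  unfolding rep_def by (rule LeastI[of _ i]) simp

private lemma rep_le: "rep i \<le> i"
  unfolding rep_def by (rule Least_le) simp

private lemma rep_eq_iff: "rep i = rep j \<longleftrightarrow> b i = b j"
  by (metis b_rep rep_def)

private lemma finite_block [simp]: "finite (block c)"
  by (simp add: block_def)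

private lemma card_block_pos: "i < N \<Longrightarrow> card (block (b i)) > 0"
  by (auto simp: card_gt_0_iff block_def)

text \<open>Column \<open>j\<close> of \<open>eigvecs\<close> is the indicator of a block if
  \<open>j\<close> is a representative, otherwise a difference of two unit vectors. Multiplying by
  it therefore takes a row sum over a block or a difference of two entries, to which the next two
  matrix identities reduce.\<close>

private lemma mult_eigvecs:
  assumes X: "X \<in> carrier_mat N N" and "i < N" "j < N"
  shows "(X * eigvecs) $$ (i, j) =
    (if rep j = j then \<Sum>k\<in>block (b j). X $$ (i, k) else X $$ (i, j) - X $$ (i, rep j))"
proof -
  have "(X * eigvecs) $$ (i, j) = (\<Sum>k<N. X $$ (i, k) * eigvecs $$ (k, j))"
    using assms by (simp add: scalar_prod_def eigvecs_def lessThan_atLeast0)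
  also have "\<dots> = (if rep j = j then \<Sum>k\<in>block (b j). X $$ (i, k)
      else (\<Sum>k<N. X $$ (i, k) * of_bool (k = j)) - (\<Sum>k<N. X $$ (i, k) * of_bool (k = rep j)))"
  proof (cases "rep j = j")
    case True
    then show ?thesis using assms
      by (auto simp: eigvecs_def block_def intro!: sum.mono_neutral_cong_right split: if_splits)
  next
    case False
    have "X $$ (i, k) * eigvecs $$ (k, j) = X $$ (i, k) * of_bool (k = j) - X $$ (i, k) * of_bool (k = rep j)"
      if "k < N" for k
      using False assms that b_rep[of j] by (auto simp: eigvecs_def)
    then show ?thesis using False by (simp add: sum_subtractf)
  qed
  also have "\<dots> = (if rep j = j then \<Sum>k\<in>block (b j). X $$ (i, k) else X $$ (i, j) - X $$ (i, rep j))"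
    using assms rep_le[of j] by (simp add: of_bool_def if_distrib cong: if_cong)
  finally show ?thesis .
qed

private lemma eigvecs_inv_mult: "eigvecs_inv * eigvecs = 1\<^sub>m N"
proof (rule eq_matI)
  fix i j assume "i < dim_row (1\<^sub>m N :: real mat)" "j < dim_col (1\<^sub>m N :: real mat)"
  then have ij: "i < N" "j < N" by auto
  have rN: "rep j < N" using rep_le[of j] ij by simp
  have carrier: "eigvecs_inv \<in> carrier_mat N N" by (simp add: eigvecs_inv_def)
  have row_sum: "(\<Sum>k\<in>block (b j). eigvecs_inv $$ (i, k)) = of_bool (i = j)" if "rep j = j"
  proof (cases "b i = b j")
    case True
    have "(\<Sum>k\<in>block (b j). eigvecs_inv $$ (i, k)) =
      (\<Sum>k\<in>block (b j). of_bool (rep i \<noteq> i \<and> i = k) + (if rep i = i then 1 else - 1) / card (block (b i)))"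
      using ij True by (intro sum.cong) (auto simp: eigvecs_inv_def block_def)
    also have "\<dots> = (\<Sum>k\<in>block (b i). of_bool (rep i \<noteq> i \<and> i = k)) + (if rep i = i then 1 else - 1)"
      using True card_block_pos[OF ij(1)] by (simp add: sum.distrib card_gt_0_iff)
    also have "(\<Sum>k\<in>block (b i). of_bool (rep i \<noteq> i \<and> i = k)) = (of_bool (rep i \<noteq> i) :: real)"
      using ij by (cases "rep i = i") (simp_all add: of_bool_def block_def)
    finally have "(\<Sum>k\<in>block (b j). eigvecs_inv $$ (i, k)) =
      of_bool (rep i \<noteq> i) + (if rep i = i then 1 else - 1)" .
    \<comment> \<open>A block has only one representative, and here it is \<open>j\<close>.\<close>
    moreover have "rep i = i \<longleftrightarrow> i = j" using that True rep_eq_iff[of i j] by metis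
    ultimately show ?thesis by simp
  next
    case False
    then show ?thesis using ij by (auto simp: eigvecs_inv_def block_def)
  qed
  show "(eigvecs_inv * eigvecs) $$ (i, j) = 1\<^sub>m N $$ (i, j)"
    unfolding mult_eigvecs[OF carrier ij]
    using ij rN row_sum b_rep[of j] rep_eq_iff[of i j]
    by (auto simp: eigvecs_inv_def)
qed (auto simp: eigvecs_def eigvecs_inv_def)

text \<open>On a block of size \<open>m\<close>, \<open>p I + q J\<close> multiplies the all-ones
  vector by \<open>p + m q\<close>, while \<open>J\<close> kills a difference of two unit vectors
  and leaves the factor \<open>p\<close>.\<close>

private lemma block_mat_eigvecs:
  fixes p q :: "'b \<Rightarrow> real"
  shows
  "block_mat N b p q * eigvecs =
     eigvecs * mat_diag N (\<lambda>j. p (b j) + of_bool (rep j = j) * card (block (b j)) * q (b j))"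
proof (rule eq_matI)
  let ?d = "\<lambda>j. p (b j) + of_bool (rep j = j) * card (block (b j)) * q (b j)"
  fix i j assume "i < dim_row (eigvecs * mat_diag N ?d)" "j < dim_col (eigvecs * mat_diag N ?d)"
  then have ij: "i < N" "j < N" by (auto simp: eigvecs_def mat_diag_def)
  have rN: "rep j < N" using rep_le[of j] ij by simp
  have carrier: "block_mat N b p q \<in> carrier_mat N N" "eigvecs \<in> carrier_mat N N"
    by (simp_all add: block_mat_def eigvecs_def)
  have row_sum: "(\<Sum>k\<in>block (b j). block_mat N b p q $$ (i, k)) =
      of_bool (b i = b j) * (p (b j) + card (block (b j)) * q (b j))"
  proof (cases "b i = b j")
    case True
    have "(\<Sum>k\<in>block (b j). block_mat N b p q $$ (i, k)) =
      (\<Sum>k\<in>block (b j). (if i = k then p (b i) else 0) + q (b i))"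
      using ij True by (intro sum.cong) (auto simp: block_mat_def block_def)
    then show ?thesis using True ij
      by (simp add: sum.distrib) (auto simp: block_def)
  next
    case False
    then show ?thesis using ij by (auto simp: block_mat_def block_def)
  qed
  show "(block_mat N b p q * eigvecs) $$ (i, j) = (eigvecs * mat_diag N ?d) $$ (i, j)"
    unfolding mult_eigvecs[OF carrier(1) ij] mat_diag_mult_right[OF carrier(2)]
    using ij rN row_sum b_rep[of j]
    by (auto simp: block_mat_def eigvecs_def)
qed (auto simp: eigvecs_def block_mat_def mat_diag_def)

text \<open>The eigenbasis makes the matrix diagonal. Each block has exactly one representative,
  which gives \<open>p + m q\<close> once; the other \<open>m - 1\<close> indices give
  \<open>p\<close>.\<close>

lemma spec_block_mat:
  fixes p q :: "'b \<Rightarrow> real"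
  shows
  "spec (block_mat N b p q) = (\<Sum>c\<in>b ` {..<N}.
     {#p c + card {k. k < N \<and> b k = c} * q c#} + replicate_mset (card {k. k < N \<and> b k = c} - 1) (p c))"
proof -
  let ?d = "\<lambda>j. p (b j) + of_bool (rep j = j) * card (block (b j)) * q (b j)"
  let ?l = "\<lambda>j. [:- ?d j, 1:]"
  have carrier: "block_mat N b p q \<in> carrier_mat N N" "eigvecs \<in> carrier_mat N N"
    "eigvecs_inv \<in> carrier_mat N N"
    by (simp_all add: block_mat_def eigvecs_def eigvecs_inv_def)
  have inv: "eigvecs * eigvecs_inv = 1\<^sub>m N"
    by (rule mat_mult_left_right_inverse[OF carrier(3,2) eigvecs_inv_mult])
  have "block_mat N b p q = eigvecs * mat_diag N ?d * eigvecs_inv"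
    unfolding block_mat_eigvecs[symmetric] using carrier inv
    by (simp add: assoc_mult_mat[of _ N N _ N _ N])
  then have "similar_mat (block_mat N b p q) (mat_diag N ?d)"
    using carrier inv eigvecs_inv_mult
    by (auto simp: mat_diag_def
        intro!: similar_matI[of _ _ eigvecs eigvecs_inv N])
  then have "char_poly (block_mat N b p q) = char_poly (mat_diag N ?d)"
    by (rule char_poly_similar)
  also have "\<dots> = (\<Prod>(a::real)\<leftarrow>diag_mat (mat_diag N ?d). [:- a, 1:])"
    by (rule char_poly_upper_triangular[of _ N]) (auto simp: mat_diag_def)
  also have "\<dots> = (\<Prod>j<N. ?l j)"
  proof -
    have "map ((\<lambda>a. [:- a, 1:]) \<circ> (\<lambda>i. mat_diag N ?d $$ (i, i))) [0..<N] = map ?l [0..<N]"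
      by (simp add: mat_diag_def)
    moreover have "dim_row (mat_diag N ?d) = N" by (simp add: mat_diag_def)
    ultimately show ?thesis
      using prod.distinct_set_conv_list[OF distinct_upt, of ?l 0 N]
      unfolding diag_mat_def by (simp only: map_map lessThan_atLeast0 set_upt)
  qed
  also have "\<dots> = (\<Prod>c\<in>b ` {..<N}. \<Prod>j\<in>block c. ?l j)"
    by (subst prod.image_gen[of _ _ b]) (auto simp: block_def)
  also have "\<dots> = (\<Prod>c\<in>b ` {..<N}. [:- (p c + card (block c) * q c), 1:] * [:- p c, 1:] ^ (card (block c) - 1))"
  proof (intro prod.cong refl)
    fix c assume "c \<in> b ` {..<N}"
    then obtain i where i: "i < N" "b i = c" by auto
    let ?r = "rep i"
    have r: "?r \<in> block c" "b ?r = c" "rep ?r = ?r"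
      using rep_le[of i] i b_rep[of i] by (auto simp: block_def rep_eq_iff)
    \<comment> \<open>The representative carries the eigenvalue of the all-ones vector; all other
      indices of the block share one linear factor.\<close>
    have "(\<Prod>j\<in>block c. ?l j) = ?l ?r * (\<Prod>j\<in>block c - {?r}. ?l j)"
      using r by (intro prod.remove) auto
    also have "(\<Prod>j\<in>block c - {?r}. ?l j) = (\<Prod>j\<in>block c - {?r}. [:- p c, 1:])"
    proof (intro prod.cong refl)
      fix j assume j: "j \<in> block c - {?r}"
      then have "rep j = ?r" using i by (auto simp: rep_eq_iff block_def)
      then show "?l j = [:- p c, 1:]" using j by (auto simp: block_def)
    qed
    also have "\<dots> = [:- p c, 1:] ^ (card (block c) - 1)"
      using r by (simp add: card_Diff_singleton)
    finally show "(\<Prod>j\<in>block c. ?l j) =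
        [:- (p c + card (block c) * q c), 1:] * [:- p c, 1:] ^ (card (block c) - 1)"
      using r by simp
  qed
  finally have cp: "char_poly (block_mat N b p q) = \<dots>" .
  have "spec (block_mat N b p q) = (\<Sum>c\<in>b ` {..<N}.
      proots ([:- (p c + card (block c) * q c), 1:] * [:- p c, 1:] ^ (card (block c) - 1)))"
    unfolding spec_def cp by (rule proots_prod) (simp del: mult_pCons_left mult_pCons_right)
  also have "\<dots> = (\<Sum>c\<in>b ` {..<N}. {#p c + card (block c) * q c#} + replicate_mset (card (block c) - 1) (p c))"
    by (intro sum.cong refl, subst proots_mult)
      (auto simp del: mult_pCons_left mult_pCons_right simp: proots_power repeat_mset_replicate_mset)
  finally show ?thesis unfolding block_def .
qed

end

section \<open>Disjoint unions of cliques\<close>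

text \<open>Each vertex lies in exactly one member of \<open>\<C>\<close>. Empty members are
  excluded, so that every member comes from some vertex and contributes one eigenvalue of all-ones
  type.\<close>

locale clique_union =
  fixes g :: "'v pair_pre_digraph" and \<C> :: "'v set set"
  assumes disjoint: "C \<in> \<C> \<Longrightarrow> D \<in> \<C> \<Longrightarrow> v \<in> C \<Longrightarrow> v \<in> D \<Longrightarrow> C = D"
    and nonempty: "{} \<notin> \<C>"
    and verts: "pverts g = \<Union> \<C>"
    and arcs: "parcs g = {(x, y). x \<noteq> y \<and> (\<exists>C\<in>\<C>. x \<in> C \<and> y \<in> C)}"
begin

context
  fixes vs
  assumes distinct: "distinct vs" and set_vs: "set vs = pverts g"
begin

section \<open>The matrices in terms of the cliques\<close>

private definition clique :: "nat \<Rightarrow> 'v set" where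
  "clique i = (THE C. C \<in> \<C> \<and> vs ! i \<in> C)"

private lemma clique_eqI: "C \<in> \<C> \<Longrightarrow> vs ! i \<in> C \<Longrightarrow> clique i = C"
  unfolding clique_def using disjoint by (intro the_equality) auto

private lemma clique:
  assumes "i < length vs"
  shows "clique i \<in> \<C>" and "vs ! i \<in> clique i"
proof -
  obtain C where "C \<in> \<C>" "vs ! i \<in> C"
    using assms set_vs verts by (metis UnionE nth_mem)
  then show "clique i \<in> \<C>" "vs ! i \<in> clique i" using clique_eqI by auto
qed

private lemma finite_clique: "C \<in> \<C> \<Longrightarrow> finite C"
  by (rule finite_subset[OF _ finite_set[of vs]]) (auto simp: set_vs verts)

text \<open>The enumeration restricts to a bijection from the fibre onto the clique, so the block
  sizes of the matrices are the clique sizes.\<close>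

private lemma card_clique:
  assumes "C \<in> \<C>"
  shows "card {k. k < length vs \<and> clique k = C} = card C"
proof (rule bij_betw_same_card[of "(!) vs"], rule bij_betw_imageI)
  show "inj_on ((!) vs) {k. k < length vs \<and> clique k = C}"
    using distinct by (auto simp: inj_on_def nth_eq_iff_index_eq)
  show "(!) vs ` {k. k < length vs \<and> clique k = C} = C"
  proof (intro equalityI subsetI)
    fix v assume "v \<in> C"
    moreover from this assms obtain k where "k < length vs" "v = vs ! k"
      using set_vs verts by (metis UnionI in_set_conv_nth)
    ultimately show "v \<in> (!) vs ` {k. k < length vs \<and> clique k = C}"
      using clique_eqI assms by auto
  qed (use clique in auto)
qed

private lemma clique_image: "clique ` {..<length vs} = \<C>"
proof (intro equalityI subsetI)
  fix C assume "C \<in> \<C>"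
  then have "{k. k < length vs \<and> clique k = C} \<noteq> {}"
    using card_clique nonempty finite_clique by (metis card.empty card_eq_0_iff)
  then show "C \<in> clique ` {..<length vs}" by auto
qed (use clique in auto)

private lemma CN_eq:
  assumes "i < length vs" "j < length vs"
  shows "CN g vs $$ (i, j) = (if i \<noteq> j \<and> clique i = clique j then real (card (clique i)) - 2 else 0)"
proof (cases "i \<noteq> j \<and> clique i = clique j")
  case True
  have ne: "vs ! i \<noteq> vs ! j" using True assms distinct by (simp add: nth_eq_iff_index_eq)
  have "{w \<in> pverts g - {vs ! i, vs ! j}. (vs ! i, w) \<in> parcs g \<and> (vs ! j, w) \<in> parcs g} =
    clique i - {vs ! i, vs ! j}"
    using clique[OF assms(1)] clique[OF assms(2)] True disjoint
    by (auto simp: verts arcs)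
  moreover have "card (clique i - {vs ! i, vs ! j}) = card (clique i) - 2"
    using clique assms True ne by (subst card_Diff_subset) auto
  \<comment> \<open>The clique contains two distinct vertices, so the truncated difference
    \<open>card (clique i) - 2\<close> agrees with the real one.\<close>
  moreover have "card {vs ! i, vs ! j} \<le> card (clique i)"
    using clique assms True by (intro card_mono finite_clique) auto
  ultimately show ?thesis using True assms ne by (simp add: CN_def)
next
  case False
  \<comment> \<open>A common neighbour lies in the cliques of both vertices, which then coincide by
    disjointness.\<close>
  have "clique i = clique j" if arcs': "(vs ! i, w) \<in> parcs g" "(vs ! j, w) \<in> parcs g" for w
  proof -
    from arcs' obtain C D where "C \<in> \<C>" "vs ! i \<in> C" "w \<in> C" "D \<in> \<C>" "vs ! j \<in> D" "w \<in> D"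
      by (auto simp: arcs)
    then show ?thesis using clique_eqI disjoint by metis
  qed
  then have "{w \<in> pverts g - {vs ! i, vs ! j}. (vs ! i, w) \<in> parcs g \<and> (vs ! j, w) \<in> parcs g} = {}"
    if "i \<noteq> j" using that False by blast
  then show ?thesis using False assms by (auto simp: CN_def simp del: Collect_empty_eq)
qed

private lemma CNRS_eq:
  assumes "i < length vs"
  shows "CNRS g vs $$ (i, i) = (real (card (clique i)) - 1) * (real (card (clique i)) - 2)"
proof -
  let ?B = "{k. k < length vs \<and> clique k = clique i}"
  have "CNRS g vs $$ (i, i) = (\<Sum>j<length vs. CN g vs $$ (i, j))"
    using assms by (simp add: CNRS_def mat_diag_def)
  also have "\<dots> = (\<Sum>j\<in>?B - {i}. real (card (clique i)) - 2)"
    using assms by (intro sum.mono_neutral_cong_right) (auto simp: CN_eq)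
  also have "\<dots> = real (card ?B - 1) * (real (card (clique i)) - 2)"
    using assms by (simp add: card_Diff_singleton)
  also have "card ?B = card (clique i)"
    using clique assms by (intro card_clique) auto
  also have "real (card (clique i) - 1) = real (card (clique i)) - 1"
    using clique[OF assms] finite_clique
    by (metis One_nat_def Suc_leI card_gt_0_iff empty_iff of_nat_1 of_nat_diff)
  finally show ?thesis .
qed

lemma length_vs: "length vs = (\<Sum>C\<in>\<C>. card C)"
proof -
  have "length vs = card (\<Union> \<C>)" using distinct set_vs verts distinct_card by metis
  also have "\<dots> = (\<Sum>C\<in>\<C>. card C)"
    by (rule card_Union_disjoint) (auto simp: pairwise_def disjnt_def finite_clique dest: disjoint)
  finally show ?thesis .
qed

text \<open>For a clique of \<open>m\<close> vertices the off-diagonal entries of \<open>CN\<close>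
  are \<open>m - 2\<close> and the row sums are \<open>(m - 1) (m - 2)\<close>. The diagonals fit
  because \<open>m (m - 2) - (m - 2)\<close> and \<open>(m - 2)^2 + (m - 2)\<close> both equal
  \<open>(m - 1) (m - 2)\<close>.\<close>

private lemma CNRS_CN_block_mat:
  "CNRS g vs - CN g vs = block_mat (length vs) clique
      (\<lambda>C. real (card C) * (real (card C) - 2)) (\<lambda>C. - (real (card C) - 2))"
  "CNRS g vs + CN g vs = block_mat (length vs) clique
      (\<lambda>C. (real (card C) - 2)\<^sup>2) (\<lambda>C. real (card C) - 2)"
proof -
  let ?N = "length vs"
  have dim: "dim_row (CN g vs) = ?N" "dim_col (CN g vs) = ?N"
    "dim_row (CNRS g vs) = ?N" "dim_col (CNRS g vs) = ?N"
    by (simp_all add: CN_def CNRS_def mat_diag_def)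
  have off_diag: "CNRS g vs $$ (i, j) = 0" if "i < ?N" "j < ?N" "i \<noteq> j" for i j
    using that by (simp add: CNRS_def mat_diag_def)
  note entries = CN_eq off_diag CNRS_eq dim
  show "CNRS g vs - CN g vs = block_mat ?N clique
      (\<lambda>C. real (card C) * (real (card C) - 2)) (\<lambda>C. - (real (card C) - 2))"
  proof (rule eq_matI)
    fix i j
    let ?B = "block_mat ?N clique (\<lambda>C. real (card C) * (real (card C) - 2)) (\<lambda>C. - (real (card C) - 2))"
    assume "i < dim_row ?B" "j < dim_col ?B"
    then show "(CNRS g vs - CN g vs) $$ (i, j) = ?B $$ (i, j)"
      by (cases "i = j") (simp_all add: entries block_mat_def algebra_simps)
  qed (simp_all add: dim block_mat_def)
  show "CNRS g vs + CN g vs = block_mat ?N clique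
      (\<lambda>C. (real (card C) - 2)\<^sup>2) (\<lambda>C. real (card C) - 2)"
  proof (rule eq_matI)
    fix i j
    let ?B = "block_mat ?N clique (\<lambda>C. (real (card C) - 2)\<^sup>2) (\<lambda>C. real (card C) - 2)"
    assume "i < dim_row ?B" "j < dim_col ?B"
    then show "(CNRS g vs + CN g vs) $$ (i, j) = ?B $$ (i, j)"
      by (cases "i = j") (simp_all add: entries block_mat_def algebra_simps power2_eq_square)
  qed (simp_all add: dim block_mat_def)
qed

section \<open>Spectra and mean of a union of cliques\<close>

lemma CNL_spec_clique_union:
  "CNL_spec g vs = (\<Sum>C\<in>\<C>. {#0#} + replicate_mset (card C - 1) (real (card C) * (real (card C) - 2)))"
  unfolding CNL_spec_def CNL_def CNRS_CN_block_mat(1) spec_block_mat clique_image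
  \<comment> \<open>Here \<open>p + m q\<close> is \<open>m (m - 2) - m (m - 2) = 0\<close>.\<close>
  by (intro sum.cong refl) (simp add: card_clique algebra_simps)

lemma CNSL_spec_clique_union:
  "CNSL_spec g vs = (\<Sum>C\<in>\<C>. {#2 * (real (card C) - 1) * (real (card C) - 2)#}
     + replicate_mset (card C - 1) ((real (card C) - 2)\<^sup>2))"
  unfolding CNSL_spec_def CNSL_def CNRS_CN_block_mat(2) spec_block_mat clique_image
proof (intro sum.cong refl)
  fix C assume "C \<in> \<C>"
  \<comment> \<open>The left side is \<open>p + m q\<close> for the signless coefficients.\<close>
  moreover have "(c - 2)\<^sup>2 + c * (c - 2) = 2 * (c - 1) * (c - 2)" for c :: real
    by (simp add: power2_eq_square algebra_simps)
  ultimately show "{#(real (card C) - 2)\<^sup>2 + real (card {k. k < length vs \<and> clique k = C}) * (real (card C) - 2)#} +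
      replicate_mset (card {k. k < length vs \<and> clique k = C} - 1) ((real (card C) - 2)\<^sup>2) =
      {#2 * (real (card C) - 1) * (real (card C) - 2)#} + replicate_mset (card C - 1) ((real (card C) - 2)\<^sup>2)"
    by (simp only: card_clique)
qed

text \<open>All \<open>m\<close> vertices of a clique have the same diagonal entry, so each clique
  enters the mean with weight \<open>m\<close>.\<close>

lemma CN_Delta_clique_union:
  "CN_Delta g vs = (\<Sum>C\<in>\<C>. real (card C) * (real (card C) - 1) * (real (card C) - 2))
     / real (\<Sum>C\<in>\<C>. card C)"
proof -
  let ?f = "\<lambda>C. (real (card C) - 1) * (real (card C) - 2)"
  have "(\<Sum>i<length vs. CNRS g vs $$ (i, i)) = (\<Sum>i<length vs. ?f (clique i))"
    by (intro sum.cong refl CNRS_eq) simp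
  also have "\<dots> = (\<Sum>C\<in>clique ` {..<length vs}. \<Sum>i\<in>{i \<in> {..<length vs}. clique i = C}. ?f (clique i))"
    by (intro sum.image_gen) simp
  also have "\<dots> = (\<Sum>C\<in>\<C>. real (card C) * (real (card C) - 1) * (real (card C) - 2))"
    unfolding clique_image by (rule sum.cong) (simp_all add: card_clique)
  finally show ?thesis by (simp add: CN_Delta_def length_vs)
qed

end

end

section \<open>Conjugacy classes and the center\<close>

text \<open>Equal fibres give a bijection between the images, sending \<open>f x\<close> to
  \<open>g x\<close>. It serves to count a conjugacy class through the quotient map.\<close>

lemma card_image_eq_card_image:
  assumes "\<And>x y. x \<in> A \<Longrightarrow> y \<in> A \<Longrightarrow> f x = f y \<longleftrightarrow> g x = g y"
  shows "card (f ` A) = card (g ` A)"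
proof -
  define F where "F v = g (inv_into A f v)" for v
  have F: "F (f x) = g x" if "x \<in> A" for x
    using assms[of "inv_into A f (f x)" x] that
    by (simp add: F_def inv_into_into f_inv_into_f)
  have "inj_on F (f ` A)" using assms F by (auto intro!: inj_onI)
  moreover have "F ` f ` A = g ` A" using F by (simp add: image_image cong: image_cong)
  ultimately show ?thesis by (metis card_image)
qed

context group
begin

section \<open>The center as a normal subgroup\<close>

lemma comm_mult:
  assumes "x \<in> carrier G" "y \<in> carrier G" "z \<in> carrier G" "x \<otimes> y = y \<otimes> x" "x \<otimes> z = z \<otimes> x"
  shows "x \<otimes> (y \<otimes> z) = y \<otimes> z \<otimes> x"
  using assms by (metis m_assoc)

lemma center_carrier: "c \<in> center G \<Longrightarrow> c \<in> carrier G"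
  by (simp add: center_def)

lemma center_comm: "c \<in> center G \<Longrightarrow> x \<in> carrier G \<Longrightarrow> c \<otimes> x = x \<otimes> c"
  by (simp add: center_def)

lemma centerI: "c \<in> carrier G \<Longrightarrow> (\<And>x. x \<in> carrier G \<Longrightarrow> c \<otimes> x = x \<otimes> c) \<Longrightarrow> c \<in> center G"
  unfolding center_def by blast

lemma center_subgroup: "subgroup (center G) G"
proof (rule subgroupI)
  show "center G \<subseteq> carrier G" using center_carrier by blast
  have "\<one> \<in> center G" by (rule centerI) simp_all
  then show "center G \<noteq> {}" by blast
next
  fix a assume a: "a \<in> center G"
  show "inv a \<in> center G"
  proof (rule centerI)
    fix x assume x: "x \<in> carrier G"
    \<comment> \<open>Inverting both sides of \<open>a \<otimes> inv x = inv x \<otimes> a\<close>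
      gives the commutation for \<open>inv a\<close>.\<close>
    have "inv (a \<otimes> inv x) = x \<otimes> inv a" "inv (inv x \<otimes> a) = inv a \<otimes> x"
      using x center_carrier[OF a] by (simp_all only: inv_mult_group inv_closed inv_inv)
    then show "inv a \<otimes> x = x \<otimes> inv a" using center_comm[OF a, of "inv x"] x by simp
  qed (simp add: center_carrier a)
next
  fix a b assume ab: "a \<in> center G" "b \<in> center G"
  show "a \<otimes> b \<in> center G"
  proof (rule centerI)
    fix x assume x: "x \<in> carrier G"
    show "a \<otimes> b \<otimes> x = x \<otimes> (a \<otimes> b)"
      using comm_mult[of x a b] x ab[THEN center_carrier] center_comm[OF ab(1) x] center_comm[OF ab(2) x]
      by simp
  qed (simp add: ab center_carrier)
qed

lemma center_normal: "center G \<lhd> G"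
  unfolding normal_inv_iff
proof (intro conjI ballI)
  fix x c assume xc: "x \<in> carrier G" "c \<in> center G"
  have "x \<otimes> c \<otimes> inv x = c \<otimes> x \<otimes> inv x" using center_comm[OF xc(2,1)] by simp
  also have "\<dots> = c" using xc center_carrier by (simp add: m_assoc)
  finally show "x \<otimes> c \<otimes> inv x \<in> center G" using xc by simp
qed (rule center_subgroup)

section \<open>Conjugacy classes as a partition\<close>

lemma conj_class_self: "x \<in> carrier G \<Longrightarrow> x \<in> conj_class G x"
  by (auto simp: conj_class_def intro!: exI[of _ \<one>])

lemma conj_class_subset: "x \<in> carrier G \<Longrightarrow> conj_class G x \<subseteq> carrier G"
  by (auto simp: conj_class_def)

lemma conj_class_mono:
  assumes "x \<in> carrier G" "y \<in> conj_class G x"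
  shows "conj_class G y \<subseteq> conj_class G x"
proof
  fix w assume "w \<in> conj_class G y"
  then obtain g k where gk: "g \<in> carrier G" "k \<in> carrier G" "y = k \<otimes> x \<otimes> inv k" "w = g \<otimes> y \<otimes> inv g"
    using assms by (auto simp: conj_class_def)
  then have "w = (g \<otimes> k) \<otimes> x \<otimes> inv (g \<otimes> k)"
    using assms by (simp add: m_assoc inv_mult_group)
  then show "w \<in> conj_class G x" using gk unfolding conj_class_def by blast
qed

lemma conj_class_sym:
  assumes "x \<in> carrier G" "y \<in> conj_class G x"
  shows "x \<in> conj_class G y"
proof -
  obtain k where k: "k \<in> carrier G" "y = k \<otimes> x \<otimes> inv k"
    using assms by (auto simp: conj_class_def)
  then have "x = inv k \<otimes> y \<otimes> inv (inv k)"
    using assms by (simp add: m_assoc) (simp flip: m_assoc)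
  then show ?thesis using k unfolding conj_class_def by blast
qed

lemma conj_class_eq:
  assumes "x \<in> carrier G" "y \<in> conj_class G x"
  shows "conj_class G y = conj_class G x"
  using assms conj_class_mono conj_class_sym conj_class_subset by (metis subset_antisym subset_iff)

lemma card_conj_classes:
  assumes "finite S" "S \<subseteq> carrier G"
    and "\<And>x. x \<in> S \<Longrightarrow> conj_class G x \<subseteq> S"
    and "\<And>x. x \<in> S \<Longrightarrow> card (conj_class G x) = k"
  shows "k * card (conj_class G ` S) = card S"
proof -
  have union: "\<Union> (conj_class G ` S) = S" using assms conj_class_self by blast
  have "k * card (conj_class G ` S) = card (\<Union> (conj_class G ` S))"
  proof (rule card_partition)
    fix c1 c2 assume "c1 \<in> conj_class G ` S" "c2 \<in> conj_class G ` S" "c1 \<noteq> c2"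
    then show "c1 \<inter> c2 = {}" using assms(2) conj_class_eq by blast
  qed (use assms union in auto)
  then show ?thesis using union by simp
qed

text \<open>Reduces the graph to a partition of the non-central elements into conjugation-invariant
  parts: elements of different parts never commute, and any two classes in one part have commuting
  members. Injectivity holds because a class determines the part that contains it; it keeps the
  resulting cliques distinct.\<close>

lemma clique_union_ccc_graph:
  assumes cover: "carrier G - center G = \<Union> \<S>"
    and disj: "\<And>S T x. S \<in> \<S> \<Longrightarrow> T \<in> \<S> \<Longrightarrow> x \<in> S \<Longrightarrow> x \<in> T \<Longrightarrow> S = T"
    and "{} \<notin> \<S>"
    and closed: "\<And>S x. S \<in> \<S> \<Longrightarrow> x \<in> S \<Longrightarrow> conj_class G x \<subseteq> S"
    and commuting: "\<And>S x y. S \<in> \<S> \<Longrightarrow> x \<in> S \<Longrightarrow> y \<in> S \<Longrightarrow>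
      \<exists>x'\<in>conj_class G x. \<exists>y'\<in>conj_class G y. x' \<otimes> y' = y' \<otimes> x'"
    and not_commuting: "\<And>S T x y. S \<in> \<S> \<Longrightarrow> T \<in> \<S> \<Longrightarrow> x \<in> S \<Longrightarrow> y \<in> T \<Longrightarrow>
      x \<otimes> y = y \<otimes> x \<Longrightarrow> S = T"
  shows "clique_union (ccc_graph G) ((`) (conj_class G) ` \<S>)"
    and "inj_on ((`) (conj_class G)) \<S>"
proof -
  have sub: "S \<subseteq> carrier G" if "S \<in> \<S>" for S using cover that by blast
  have same: "S = T" if "S \<in> \<S>" "T \<in> \<S>" "x \<in> S" "y \<in> T" "conj_class G x = conj_class G y" for S T x y
    using that closed conj_class_self disj sub by (metis subset_iff)
  show "clique_union (ccc_graph G) ((`) (conj_class G) ` \<S>)"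
  proof
    fix C D v assume "C \<in> (`) (conj_class G) ` \<S>" "D \<in> (`) (conj_class G) ` \<S>" "v \<in> C" "v \<in> D"
    then obtain S T x y where ST: "S \<in> \<S>" "C = conj_class G ` S" "T \<in> \<S>" "D = conj_class G ` T"
      "x \<in> S" "y \<in> T" and "v = conj_class G x" "v = conj_class G y"
      by blast
    then have "S = T" using same[of S T x y] by simp
    then show "C = D" using ST by simp
  next
    show "{} \<notin> (`) (conj_class G) ` \<S>" using assms(3) by auto
  next
    show "pverts (ccc_graph G) = \<Union> ((`) (conj_class G) ` \<S>)"
      by (auto simp: ccc_graph_def cover)
  next
    have "(\<exists>x'\<in>X. \<exists>y'\<in>Y. x' \<otimes> y' = y' \<otimes> x') \<longleftrightarrow> (\<exists>S\<in>\<S>. X \<in> conj_class G ` S \<and> Y \<in> conj_class G ` S)"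
      if XY: "X \<in> conj_class G ` (carrier G - center G)" "Y \<in> conj_class G ` (carrier G - center G)" for X Y
    proof
      assume "\<exists>x'\<in>X. \<exists>y'\<in>Y. x' \<otimes> y' = y' \<otimes> x'"
      then obtain x' y' where comm: "x' \<in> X" "y' \<in> Y" "x' \<otimes> y' = y' \<otimes> x'" by blast
      obtain S x where S: "S \<in> \<S>" "x \<in> S" "X = conj_class G x" using XY(1) cover by auto
      obtain T y where T: "T \<in> \<S>" "y \<in> T" "Y = conj_class G y" using XY(2) cover by auto
      \<comment> \<open>Invariance puts the commuting conjugates into the same parts as
        \<open>x\<close> and \<open>y\<close>, where \<open>not_commuting\<close> applies.\<close>
      have "x' \<in> S" "y' \<in> T" using closed S T comm by blast+
      then have "S = T" using not_commuting S T comm by blast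
      then show "\<exists>S\<in>\<S>. X \<in> conj_class G ` S \<and> Y \<in> conj_class G ` S" using S T by blast
    next
      assume "\<exists>S\<in>\<S>. X \<in> conj_class G ` S \<and> Y \<in> conj_class G ` S"
      then show "\<exists>x'\<in>X. \<exists>y'\<in>Y. x' \<otimes> y' = y' \<otimes> x'" using commuting by auto
    qed
    note adjacent_iff = this
    have vert: "X \<in> conj_class G ` (carrier G - center G)" if "S \<in> \<S>" "X \<in> conj_class G ` S" for X S
      using that cover by blast
    have arcs_iff: "(X, Y) \<in> parcs (ccc_graph G) \<longleftrightarrow>
      X \<noteq> Y \<and> (\<exists>C\<in>(`) (conj_class G) ` \<S>. X \<in> C \<and> Y \<in> C)" for X Y
    proof -
      have "(\<exists>C\<in>(`) (conj_class G) ` \<S>. X \<in> C \<and> Y \<in> C) \<longleftrightarrow>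
          (\<exists>S\<in>\<S>. X \<in> conj_class G ` S \<and> Y \<in> conj_class G ` S)"
        by (simp only: bex_simps)
      moreover have "(X, Y) \<in> parcs (ccc_graph G) \<longleftrightarrow>
          X \<in> conj_class G ` (carrier G - center G) \<and> Y \<in> conj_class G ` (carrier G - center G)
          \<and> X \<noteq> Y \<and> (\<exists>x'\<in>X. \<exists>y'\<in>Y. x' \<otimes> y' = y' \<otimes> x')"
        by (simp only: ccc_graph_def pair_pre_digraph.simps mem_Collect_eq case_prod_conv)
      ultimately show ?thesis using adjacent_iff[of X Y] vert[of _ X] vert[of _ Y] by metis
    qed
    show "parcs (ccc_graph G) =
      {(X, Y). X \<noteq> Y \<and> (\<exists>C\<in>(`) (conj_class G) ` \<S>. X \<in> C \<and> Y \<in> C)}"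
    proof (rule Set.set_eqI)
      fix p
      show "p \<in> parcs (ccc_graph G) \<longleftrightarrow>
        p \<in> {(X, Y). X \<noteq> Y \<and> (\<exists>C\<in>(`) (conj_class G) ` \<S>. X \<in> C \<and> Y \<in> C)}"
        by (cases p) (simp only: arcs_iff mem_Collect_eq case_prod_conv)
    qed
  qed
  show "inj_on ((`) (conj_class G)) \<S>"
  proof (rule inj_onI)
    fix S T assume ST: "S \<in> \<S>" "T \<in> \<S>" "conj_class G ` S = conj_class G ` T"
    have "S \<noteq> {}" using ST(1) assms(3) by metis
    then obtain x where x: "x \<in> S" by auto
    then have "conj_class G x \<in> conj_class G ` T" using ST(3) by auto
    then obtain y where "y \<in> T" "conj_class G x = conj_class G y" by auto
    then show "S = T" using same[OF ST(1,2) x] by simp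
  qed
qed

end

section \<open>Groups with dihedral central quotient\<close>

text \<open>A surjection \<open>h\<close> whose kernel is the center carries the isomorphism of the
  central quotient with the dihedral group and allows working with elements instead of
  cosets.\<close>

locale central_dihedral = group G for G :: "('a, 'b) monoid_scheme" (structure) +
  fixes h :: "'a \<Rightarrow> int \<times> bool" and n :: nat
  assumes finite_carrier: "finite (carrier G)" and n_ge: "n \<ge> 3"
    and hom: "h \<in> hom G (dihedral n)" and surj: "h ` carrier G = carrier (dihedral n)"
    and kernel: "kernel G (dihedral n) h = center G"
begin

section \<open>The quotient map and its fibres\<close>

lemma group_hom: "group_hom G (dihedral n) h"
  using hom group_dihedral[of n] n_ge is_group by (simp add: group_hom_def group_hom_axioms_def)

lemmas h_mult = group_hom.hom_mult[OF group_hom]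
  and h_closed = group_hom.hom_closed[OF group_hom]
  and h_one = group_hom.hom_one[OF group_hom]
  and h_inv = group_hom.hom_inv[OF group_hom]

definition "rots = {x \<in> carrier G. \<not> snd (h x)}"
definition "refs = {x \<in> carrier G. snd (h x)}"

lemma snd_mult: "x \<in> carrier G \<Longrightarrow> y \<in> carrier G \<Longrightarrow> snd (h (x \<otimes> y)) \<longleftrightarrow> snd (h x) \<noteq> snd (h y)"
  by (simp add: h_mult dihedral_def split: prod.splits)

lemma snd_inv: "x \<in> carrier G \<Longrightarrow> snd (h (inv x)) = snd (h x)"
  using snd_mult[of x "inv x"] by (simp add: h_one dihedral_def)

lemma fst_range: "x \<in> carrier G \<Longrightarrow> fst (h x) \<in> {0..<int n}"
  using h_closed[of x] by (auto simp: dihedral_def)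

lemma h_surj: "0 \<le> i \<Longrightarrow> i < int n \<Longrightarrow> \<exists>x\<in>carrier G. h x = (i, e)"
proof -
  assume "0 \<le> i" "i < int n"
  then have "(i, e) \<in> h ` carrier G" by (simp add: surj) (simp add: dihedral_def)
  then show ?thesis by (metis imageE)
qed

lemma center_iff: "c \<in> center G \<longleftrightarrow> c \<in> carrier G \<and> h c = (0, False)"
  by (simp add: kernel[symmetric] kernel_def dihedral_def)

lemma center_subset_rots: "center G \<subseteq> rots"
  by (auto simp: center_iff rots_def)

lemma h_eq_iff:
  assumes "x \<in> carrier G" "y \<in> carrier G"
  shows "h x = h y \<longleftrightarrow> inv y \<otimes> x \<in> center G"
proof -
  have H: "group (dihedral n)" using group_dihedral n_ge by simp
  have "inv y \<otimes> x \<in> center G \<longleftrightarrow> inv\<^bsub>dihedral n\<^esub> (h y) \<otimes>\<^bsub>dihedral n\<^esub> h x = \<one>\<^bsub>dihedral n\<^esub>"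
    using assms by (simp add: kernel[symmetric] kernel_def h_mult h_inv)
  also have "\<dots> \<longleftrightarrow> h x = h y"
    using assms group.inv_solve_left'[OF H, of "\<one>\<^bsub>dihedral n\<^esub>" "h y" "h x"]
    by (simp add: h_closed group.is_monoid[OF H] monoid.r_one[OF group.is_monoid[OF H]]
        monoid.one_closed[OF group.is_monoid[OF H]])
  finally show ?thesis by simp
qed

lemma h_eqE:
  assumes "x \<in> carrier G" "y \<in> carrier G" "h x = h y"
  obtains c where "c \<in> center G" "x = y \<otimes> c"
proof
  show "inv y \<otimes> x \<in> center G" using h_eq_iff assms by simp
  show "x = y \<otimes> (inv y \<otimes> x)" using assms by (simp flip: m_assoc)
qed

lemma h_mult_center:
  assumes "x \<in> carrier G" "c \<in> center G"
  shows "h (x \<otimes> c) = h x"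
proof -
  have "h c = (0, False)" "c \<in> carrier G" using assms by (simp_all add: center_iff)
  then show ?thesis using assms(1) h_closed[of x]
    by (auto simp: h_mult dihedral_def split: prod.splits)
qed

text \<open>Each fibre of \<open>h\<close> is a coset of the center, so \<open>h\<close> is
  \<open>card (center G)\<close> to one.\<close>

lemma card_preimage:
  assumes "T \<subseteq> carrier (dihedral n)"
  shows "card {x \<in> carrier G. h x \<in> T} = card T * card (center G)"
proof -
  have fibre: "card {x \<in> carrier G. h x = p} = card (center G)" if "p \<in> T" for p
  proof -
    obtain g where g: "g \<in> carrier G" "h g = p"
      using subsetD[OF assms \<open>p \<in> T\<close>] unfolding surj[symmetric] by auto
    have "{x \<in> carrier G. h x = p} = (\<otimes>) g ` center G"
    proof (intro equalityI subsetI)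
      fix x assume "x \<in> {x \<in> carrier G. h x = p}"
      then obtain c where "c \<in> center G" "x = g \<otimes> c" using g h_eqE[of x g] by auto
      then show "x \<in> (\<otimes>) g ` center G" by blast
    qed (use g h_mult_center center_carrier in auto)
    moreover have "inj_on ((\<otimes>) g) (center G)"
      using g center_carrier by (intro inj_onI) simp
    ultimately show ?thesis by (simp add: card_image)
  qed
  have finite: "finite T" using assms by (rule finite_subset) (simp add: dihedral_def)
  have "{x \<in> carrier G. h x \<in> T} = (\<Union>p\<in>T. {x \<in> carrier G. h x = p})" by auto
  also have "card \<dots> = (\<Sum>p\<in>T. card {x \<in> carrier G. h x = p})"
    using finite finite_carrier by (intro card_UN_disjoint) auto
  also have "\<dots> = card T * card (center G)" using fibre by simp
  finally show ?thesis .
qed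

text \<open>\<open>rots\<close> is cyclic modulo central elements: with a lift \<open>r\<close> of
  the generating rotation, every element is a power of \<open>r\<close> times a central element, and
  such products commute.\<close>

lemma rots_comm:
  assumes "x \<in> rots" "y \<in> rots"
  shows "x \<otimes> y = y \<otimes> x"
proof -
  obtain r where r: "r \<in> carrier G" "h r = (1, False)" using h_surj[of 1 False] n_ge by auto
  have power: "\<exists>(k::nat). \<exists>c\<in>center G. x = r [^] k \<otimes> c" if "x \<in> rots" for x
  proof -
    have "h (r [^] k) = (int k mod int n, False)" for k :: nat
      using r n_ge by (simp add: group_hom.hom_nat_pow[OF group_hom] dihedral_rotation_power)
    \<comment> \<open>The exponent is the first coordinate itself, which already lies between
      \<open>0\<close> and \<open>n - 1\<close>.\<close>
    then have "h (r [^] nat (fst (h x))) = (int (nat (fst (h x))) mod int n, False)" .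
    also have "\<dots> = h x"
      using that fst_range[of x] by (cases "h x") (simp add: rots_def)
    finally have "h (r [^] nat (fst (h x))) = h x" .
    moreover have "x \<in> carrier G" using that by (simp add: rots_def)
    ultimately show ?thesis using r h_eqE[of x "r [^] nat (fst (h x))"] by (metis nat_pow_closed)
  qed
  obtain k l :: nat and c d where
    "c \<in> center G" "d \<in> center G" and xy: "x = r [^] k \<otimes> c" "y = r [^] l \<otimes> d"
    using power assms by meson
  note cd = this(1,2) this(1,2)[THEN center_carrier]
  have pow: "r [^] k \<in> carrier G" "r [^] l \<in> carrier G" using r by auto
  have "r [^] k \<otimes> r [^] l = r [^] l \<otimes> r [^] k"
    using r by (simp add: nat_pow_mult add.commute)
  then have "r [^] k \<otimes> y = y \<otimes> r [^] k"
    unfolding xy using cd pow center_comm[OF cd(2) pow(1)] by (intro comm_mult) auto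
  then have "y \<otimes> (r [^] k \<otimes> c) = r [^] k \<otimes> c \<otimes> y"
    using cd pow center_comm[OF cd(1)] assms(2) by (intro comm_mult) (auto simp: rots_def)
  then show ?thesis using xy by simp
qed

text \<open>\<open>x\<close> commutes with all of \<open>rots\<close>, and any \<open>g\<close>
  outside \<open>rots\<close> is \<open>a \<otimes> y\<close> with \<open>a\<close> in
  \<open>rots\<close>.\<close>

lemma central_of_comm:
  assumes "x \<in> rots" "y \<in> refs" "x \<otimes> y = y \<otimes> x"
  shows "x \<in> center G"
proof -
  have xy: "x \<in> carrier G" "y \<in> carrier G" using assms by (auto simp: rots_def refs_def)
  have "x \<otimes> g = g \<otimes> x" if g: "g \<in> carrier G" for g
  proof (cases "g \<in> rots")
    case True
    then show ?thesis using rots_comm assms by blast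
  next
    case False
    let ?a = "g \<otimes> inv y"
    have "?a \<in> rots" using False g xy assms(2) by (simp add: rots_def refs_def snd_mult snd_inv)
    then have "x \<otimes> ?a = ?a \<otimes> x" using rots_comm assms by blast
    moreover have "?a \<otimes> y = g" using g xy by (simp add: m_assoc)
    ultimately show ?thesis using assms(3) g xy by (metis m_assoc m_closed inv_closed)
  qed
  then show ?thesis using xy by (simp add: center_def)
qed

section \<open>Conjugacy classes of rotations and reflections\<close>

lemma conj_class_center:
  assumes "x \<in> carrier G" "y \<in> conj_class G x" "y \<in> center G"
  shows "x \<in> center G"
proof -
  obtain g where g: "g \<in> carrier G" "x = g \<otimes> y \<otimes> inv g"
    using conj_class_sym[OF assms(1,2)] by (auto simp: conj_class_def)
  then show ?thesis using normal.inv_op_closed2[OF center_normal] assms(3) by simp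
qed

lemma snd_conj_class: "x \<in> carrier G \<Longrightarrow> y \<in> conj_class G x \<Longrightarrow> snd (h y) = snd (h x)"
  by (auto simp: conj_class_def snd_mult snd_inv)

text \<open>Conjugation by \<open>rots\<close> fixes \<open>x\<close>, and every element outside
  \<open>rots\<close> has the form \<open>a \<otimes> s\<close> with \<open>a\<close> in
  \<open>rots\<close>, hence gives the same conjugate \<open>y\<close>. If \<open>y\<close> were
  \<open>x\<close>, then \<open>x\<close> would commute with \<open>s\<close> and be
  central.\<close>

lemma card_conj_class_rot:
  assumes "x \<in> rots - center G"
  shows "card (conj_class G x) = 2"
proof -
  have x: "x \<in> carrier G" using assms by (simp add: rots_def)
  obtain s where "s \<in> carrier G" "h s = (0, True)" using h_surj[of 0 True] n_ge by auto
  then have s: "s \<in> refs" by (simp add: refs_def)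
  then have s': "s \<in> carrier G" by (simp add: refs_def)
  define y where "y = s \<otimes> x \<otimes> inv s"
  have y: "y \<in> rots" "y \<in> carrier G"
    using s s' x assms by (simp_all add: y_def rots_def refs_def snd_mult snd_inv)
  have fixed: "g \<otimes> w \<otimes> inv g = w" if "g \<in> rots" "w \<in> rots" for g w
    using that rots_comm[OF that] by (simp add: rots_def m_assoc)
  have "conj_class G x = {x, y}"
  proof (intro equalityI subsetI)
    fix w assume "w \<in> conj_class G x"
    then obtain g where g: "g \<in> carrier G" "w = g \<otimes> x \<otimes> inv g" by (auto simp: conj_class_def)
    show "w \<in> {x, y}"
    proof (cases "g \<in> rots")
      case True
      then show ?thesis using g fixed assms by auto
    next
      case False
      let ?a = "g \<otimes> inv s"
      have a: "?a \<in> rots" using False g s s' by (simp add: rots_def refs_def snd_mult snd_inv)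
      have "w = ?a \<otimes> y \<otimes> inv ?a"
        using g s' x by (simp add: y_def m_assoc inv_mult_group) (simp flip: m_assoc)
      then show ?thesis using fixed[OF a y(1)] by simp
    qed
  next
    fix w assume "w \<in> {x, y}"
    then show "w \<in> conj_class G x"
      using conj_class_self[OF x] s' by (auto simp: y_def conj_class_def)
  qed
  moreover have "x \<noteq> y"
  proof
    assume "x = y"
    then have "x \<otimes> s = s \<otimes> x" using s' x by (metis y_def inv_solve_right' m_closed)
    then show False using central_of_comm s assms by blast
  qed
  ultimately show ?thesis by simp
qed

text \<open>Since \<open>y\<close> commutes with itself, conjugation by \<open>g\<close> outside
  \<open>rots\<close> acts on \<open>y\<close> as conjugation by \<open>g \<otimes> inv y\<close>,
  which lies in \<open>rots\<close>.\<close>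

lemma conj_class_ref:
  assumes "y \<in> refs"
  shows "conj_class G y = (\<lambda>a. a \<otimes> y \<otimes> inv a) ` rots"
proof (intro equalityI subsetI)
  have y: "y \<in> carrier G" using assms by (simp add: refs_def)
  fix w assume "w \<in> conj_class G y"
  then obtain g where g: "g \<in> carrier G" "w = g \<otimes> y \<otimes> inv g" by (auto simp: conj_class_def)
  show "w \<in> (\<lambda>a. a \<otimes> y \<otimes> inv a) ` rots"
  proof (cases "g \<in> rots")
    case False
    let ?a = "g \<otimes> inv y"
    have "?a \<in> rots" using False g y assms by (simp add: rots_def refs_def snd_mult snd_inv)
    moreover have "w = ?a \<otimes> y \<otimes> inv ?a"
      using g y by (simp add: m_assoc inv_mult_group)
    ultimately show ?thesis by blast
  qed (use g in blast)
qed (auto simp: conj_class_def rots_def)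

text \<open>Conjugators \<open>a\<close> and \<open>b\<close> in \<open>rots\<close> give the same
  conjugate iff \<open>inv b \<otimes> a\<close> commutes with \<open>y\<close>, that is, iff it is
  central. The class is thus as large as the image of \<open>rots\<close> under
  \<open>h\<close>.\<close>

lemma card_conj_class_ref:
  assumes "y \<in> refs"
  shows "card (conj_class G y) = n"
proof -
  have y: "y \<in> carrier G" using assms by (simp add: refs_def)
  have "a \<otimes> y \<otimes> inv a = b \<otimes> y \<otimes> inv b \<longleftrightarrow> h a = h b" if ab: "a \<in> rots" "b \<in> rots" for a b
  proof -
    have ab': "a \<in> carrier G" "b \<in> carrier G" using ab by (simp_all add: rots_def)
    let ?d = "inv b \<otimes> a"
    have "a \<otimes> y \<otimes> inv a = b \<otimes> y \<otimes> inv b \<longleftrightarrow> ?d \<otimes> y = y \<otimes> ?d"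
    proof -
      have "a \<otimes> y \<otimes> inv a = b \<otimes> y \<otimes> inv b \<longleftrightarrow> a \<otimes> y = b \<otimes> y \<otimes> inv b \<otimes> a"
        using ab' y by (simp add: inv_solve_right')
      also have "\<dots> \<longleftrightarrow> ?d \<otimes> y = y \<otimes> ?d"
        using ab' y by (simp add: m_assoc inv_solve_left')
      finally show ?thesis .
    qed
    also have "\<dots> \<longleftrightarrow> ?d \<in> center G"
    proof
      assume "?d \<otimes> y = y \<otimes> ?d"
      moreover have "?d \<in> rots" using ab by (simp add: rots_def snd_mult snd_inv)
      ultimately show "?d \<in> center G" using central_of_comm assms by blast
    qed (simp add: center_comm y)
    also have "\<dots> \<longleftrightarrow> h a = h b" using h_eq_iff ab' by simp
    finally show ?thesis .
  qed
  then have "card (conj_class G y) = card (h ` rots)"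
    unfolding conj_class_ref[OF assms] by (rule card_image_eq_card_image)
  also have "h ` rots = {0..<int n} \<times> {False}"
  proof (intro equalityI subsetI)
    fix p assume "p \<in> h ` rots"
    then show "p \<in> {0..<int n} \<times> {False}" using fst_range by (auto simp: rots_def mem_Times_iff)
  next
    fix p assume p: "p \<in> {0..<int n} \<times> {False}"
    then obtain x where "x \<in> carrier G" "h x = p" using h_surj[of "fst p" False] by force
    then show "p \<in> h ` rots" using p by (auto simp: rots_def)
  qed
  finally show ?thesis by (simp add: card_cartesian_product)
qed

text \<open>This lifts the dihedral identity
  \<open>r^k (r^i s) r^(-k) = r^(i + 2 k) s\<close>.\<close>

lemma fst_conj_ref:
  assumes "a \<in> rots" "y \<in> refs"
  shows "fst (h (a \<otimes> y \<otimes> inv a)) = (fst (h y) + 2 * fst (h a)) mod int n"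
proof -
  let ?w = "a \<otimes> y \<otimes> inv a"
  have ay: "a \<in> carrier G" "y \<in> carrier G" using assms by (auto simp: rots_def refs_def)
  have "\<not> snd (h a)" "snd (h y)" using assms by (simp_all add: rots_def refs_def)
  then have "snd (h ?w)" using ay by (simp add: snd_mult snd_inv)
  with \<open>\<not> snd (h a)\<close> \<open>snd (h y)\<close> obtain k i j
    where h: "h a = (k, False)" "h y = (i, True)" "h ?w = (j, True)"
    by (metis (full_types) prod.collapse)
  \<comment> \<open>Applying \<open>h\<close> to this form avoids a formula for inverses in the
    dihedral group.\<close>
  have "?w \<otimes> a = a \<otimes> y" using ay by (simp add: m_assoc)
  then have "h ?w \<otimes>\<^bsub>dihedral n\<^esub> h a = h a \<otimes>\<^bsub>dihedral n\<^esub> h y"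
    using ay h_mult[of ?w a] h_mult[of a y] by simp
  then have "(j - k) mod int n = (k + i) mod int n" unfolding h by (simp add: dihedral_def)
  then have "(j - k + k) mod int n = (k + i + k) mod int n" by (metis mod_add_left_eq)
  moreover have "j mod int n = j" using fst_range[of ?w] ay h by simp
  ultimately show ?thesis unfolding h by (simp add: algebra_simps)
qed

text \<open>Once a conjugate of \<open>x\<close> has the same image as \<open>y\<close>, the two
  differ by a central factor and so commute.\<close>

lemma ref_conj_comm:
  assumes "x \<in> refs" "y \<in> refs" "(fst (h x) + 2 * k) mod int n = fst (h y)"
  shows "\<exists>x'\<in>conj_class G x. \<exists>y'\<in>conj_class G y. x' \<otimes> y' = y' \<otimes> x'"
proof -
  have xy: "x \<in> carrier G" "y \<in> carrier G" using assms by (auto simp: refs_def)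
  obtain a where a: "a \<in> carrier G" "h a = (k mod int n, False)"
    using h_surj[of "k mod int n" False] n_ge by auto
  let ?w = "a \<otimes> x \<otimes> inv a"
  have w: "?w \<in> conj_class G x" "?w \<in> carrier G" using a xy by (auto simp: conj_class_def)
  have "fst (h ?w) = fst (h y)"
    using fst_conj_ref[of a x] a assms mod_add_right_eq[of "fst (h x)" "2 * (k mod int n)" "int n"]
      mod_add_right_eq[of "fst (h x)" "2 * k" "int n"]
    by (simp add: rots_def mod_mult_right_eq)
  then have "h ?w = h y" using snd_conj_class[OF xy(1) w(1)] assms by (simp add: refs_def prod_eq_iff)
  then obtain c where "c \<in> center G" "?w = y \<otimes> c" using h_eqE w xy by metis
  then have "?w \<otimes> y = y \<otimes> ?w" using xy center_comm center_carrier by (metis m_assoc)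
  then show ?thesis using w conj_class_self xy by blast
qed

text \<open>\<open>inv y \<otimes> x\<close> lies in \<open>rots\<close> and commutes with the
  reflection \<open>y\<close>, hence is central.\<close>

lemma ref_comm_h_eq:
  assumes "x \<in> refs" "y \<in> refs" "x \<otimes> y = y \<otimes> x"
  shows "h x = h y"
proof -
  have xy: "x \<in> carrier G" "y \<in> carrier G" using assms by (auto simp: refs_def)
  have "inv y \<otimes> x \<in> rots"
    using assms xy by (simp add: rots_def refs_def snd_mult snd_inv)
  moreover have "inv y \<otimes> x \<otimes> y = y \<otimes> (inv y \<otimes> x)"
    using assms(3) xy by (metis inv_closed l_inv l_one m_assoc m_closed r_inv)
  ultimately show ?thesis using central_of_comm assms(2) h_eq_iff xy by blast
qed

section \<open>Counting the classes\<close>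

lemma conj_class_rots: "x \<in> rots - center G \<Longrightarrow> conj_class G x \<subseteq> rots - center G"
  using conj_class_center snd_conj_class conj_class_subset by (fastforce simp: rots_def)

lemma conj_class_refs: "x \<in> refs \<Longrightarrow> conj_class G x \<subseteq> refs"
  using snd_conj_class conj_class_subset by (fastforce simp: refs_def)

lemma card_center_pos: "card (center G) > 0"
  using finite_carrier center_subgroup finite_subset subgroup.subset
  by (metis card_gt_0_iff subgroup.one_closed empty_iff)

lemma card_rot_classes: "2 * card (conj_class G ` (rots - center G)) = (n - 1) * card (center G)"
proof -
  \<comment> \<open>The center is the fibre over the trivial rotation, which leaves the exponents
    from \<open>1\<close> to \<open>n - 1\<close>.\<close>
  have "rots - center G = {x \<in> carrier G. h x \<in> {1..<int n} \<times> {False}}"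
  proof (rule Set.set_eqI)
    fix x
    show "x \<in> rots - center G \<longleftrightarrow> x \<in> {x \<in> carrier G. h x \<in> {1..<int n} \<times> {False}}"
      using fst_range[of x] by (cases "h x") (auto simp: rots_def center_iff)
  qed
  then have "card (rots - center G) = card ({1..<int n} \<times> {False}) * card (center G)"
    by (simp only:) (rule card_preimage, auto simp: dihedral_def)
  moreover have "2 * card (conj_class G ` (rots - center G)) = card (rots - center G)"
    using finite_carrier conj_class_rots card_conj_class_rot
    by (intro card_conj_classes) (auto simp: rots_def)
  ultimately show ?thesis by (simp add: card_cartesian_product nat_minus_as_int)
qed

text \<open>Every exponent in \<open>R\<close> has \<open>card (center G)\<close> preimages in
  \<open>S\<close>, and each class has \<open>n\<close> elements. \<open>R\<close> will be all
  exponents for odd \<open>n\<close> and one parity class for even \<open>n\<close>.\<close>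

lemma card_ref_classes:
  assumes "R \<subseteq> {0..<int n}" and "S = {x \<in> refs. fst (h x) \<in> R}"
    and "\<And>x. x \<in> S \<Longrightarrow> conj_class G x \<subseteq> S"
  shows "n * card (conj_class G ` S) = card R * card (center G)"
proof -
  have "S = {x \<in> carrier G. h x \<in> R \<times> {True}}"
    using assms by (auto simp: refs_def mem_Times_iff)
  then have "card S = card (R \<times> {True}) * card (center G)"
    using assms(1) by (simp only:) (rule card_preimage, auto simp: dihedral_def)
  moreover have "n * card (conj_class G ` S) = card S"
    using finite_carrier assms card_conj_class_ref
    by (intro card_conj_classes) (auto simp: refs_def)
  ultimately show ?thesis by (simp add: card_cartesian_product)
qed

text \<open>Odd and even \<open>n\<close> differ only in the partition \<open>\<P>\<close> of the
  reflections. The non-central rotations form one further part, as they commute with each other and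
  never with a reflection. Commuting reflections have equal images, so \<open>saturated\<close> puts
  them into the same part.\<close>

lemma clique_union_refs:
  assumes cover: "\<Union> \<P> = refs" and "{} \<notin> \<P>"
    and disj: "\<And>S T x. S \<in> \<P> \<Longrightarrow> T \<in> \<P> \<Longrightarrow> x \<in> S \<Longrightarrow> x \<in> T \<Longrightarrow> S = T"
    and closed: "\<And>S x. S \<in> \<P> \<Longrightarrow> x \<in> S \<Longrightarrow> conj_class G x \<subseteq> S"
    and saturated: "\<And>S x y. S \<in> \<P> \<Longrightarrow> x \<in> S \<Longrightarrow> y \<in> refs \<Longrightarrow> h x = h y \<Longrightarrow> y \<in> S"
    and commuting: "\<And>S x y. S \<in> \<P> \<Longrightarrow> x \<in> S \<Longrightarrow> y \<in> S \<Longrightarrow>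
      \<exists>k. (fst (h x) + 2 * k) mod int n = fst (h y)"
  defines "\<S> \<equiv> insert (rots - center G) \<P>"
  shows "clique_union (ccc_graph G) ((`) (conj_class G) ` \<S>)"
    and "inj_on ((`) (conj_class G)) \<S>"
    and "rots - center G \<notin> \<P>"
proof -
  have rots_ne: "rots - center G \<noteq> {}"
    using h_surj[of 1 False] n_ge by (auto simp: rots_def center_iff)
  have disjoint: "x \<notin> refs" if "x \<in> rots" for x using that by (simp add: rots_def refs_def)
  have sub: "x \<in> refs" if "S \<in> \<P>" "x \<in> S" for S x using that cover by blast
  show "rots - center G \<notin> \<P>" using rots_ne sub disjoint by blast
  have cover': "carrier G - center G = \<Union> \<S>"
    using center_subset_rots cover unfolding \<S>_def by (auto simp: rots_def refs_def)
  have disj': "S = T" if "S \<in> \<S>" "T \<in> \<S>" "x \<in> S" "x \<in> T" for S T x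
    using that disj sub disjoint unfolding \<S>_def by blast
  have closed': "conj_class G x \<subseteq> S" if "S \<in> \<S>" "x \<in> S" for S x
    using that closed conj_class_rots unfolding \<S>_def by blast
  have commuting': "\<exists>x'\<in>conj_class G x. \<exists>y'\<in>conj_class G y. x' \<otimes> y' = y' \<otimes> x'"
    if S: "S \<in> \<S>" "x \<in> S" "y \<in> S" for S x y
  proof (cases "S \<in> \<P>")
    case True
    then show ?thesis using S commuting sub ref_conj_comm by meson
  next
    case False
    then have "x \<in> rots" "y \<in> rots" using S by (auto simp: \<S>_def)
    then show ?thesis using rots_comm conj_class_self unfolding rots_def by blast
  qed
  have not_commuting': "S = T" if ST: "S \<in> \<S>" "T \<in> \<S>" "x \<in> S" "y \<in> T" "x \<otimes> y = y \<otimes> x" for S T x y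
  proof (cases "S \<in> \<P>"; cases "T \<in> \<P>")
    assume "S \<in> \<P>" "T \<in> \<P>"
    then show ?thesis using ST ref_comm_h_eq saturated disj sub by metis
  next
    assume "S \<notin> \<P>" "T \<in> \<P>"
    then have "x \<in> rots - center G" "y \<in> refs" using ST sub by (auto simp: \<S>_def)
    then show ?thesis using central_of_comm ST by blast
  next
    assume "S \<in> \<P>" "T \<notin> \<P>"
    then have "y \<in> rots - center G" "x \<in> refs" using ST sub by (auto simp: \<S>_def)
    then show ?thesis using central_of_comm[of y x] ST by simp
  qed (use ST in \<open>auto simp: \<S>_def\<close>)
  have "{} \<notin> \<S>" using rots_ne assms(2) unfolding \<S>_def by blast
  show "clique_union (ccc_graph G) ((`) (conj_class G) ` \<S>)"
    by (rule clique_union_ccc_graph[of \<S>]) (fact+)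
  show "inj_on ((`) (conj_class G)) \<S>"
    by (rule clique_union_ccc_graph[of \<S>]) (fact+)
qed

text \<open>Conjugation shifts the exponent of a reflection by \<open>2 k\<close>. For odd
  \<open>n\<close> this reaches every exponent, so the reflections form a single part.\<close>

lemma ccc_graph_odd:
  assumes "odd n"
  obtains A B where "clique_union (ccc_graph G) {A, B}" "A \<noteq> B"
    "2 * card A = (n - 1) * card (center G)" "card B = card (center G)"
proof
  have refs_ne: "refs \<noteq> {}"
    using h_surj[of 0 True] n_ge by (auto simp: refs_def)
  have "\<exists>k. (fst (h x) + 2 * k) mod int n = fst (h y)" if "x \<in> refs" "y \<in> refs" for x y
  proof
    let ?d = "fst (h y) - fst (h x)"
    \<comment> \<open>\<open>(n + 1) / 2\<close> is the inverse of \<open>2\<close> modulo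
      \<open>n\<close>.\<close>
    have "even (int n + 1)" using assms by simp
    then have "2 * ((int n + 1) div 2) = int n + 1" by (rule dvd_mult_div_cancel)
    then have "2 * (?d * ((int n + 1) div 2)) = ?d * (int n + 1)" by (metis mult.left_commute)
    then have "fst (h x) + 2 * (?d * ((int n + 1) div 2)) = fst (h y) + ?d * int n"
      by (simp add: algebra_simps)
    then show "(fst (h x) + 2 * (?d * ((int n + 1) div 2))) mod int n = fst (h y)"
      using fst_range[of y] that by (simp add: refs_def)
  qed
  then have *: "clique_union (ccc_graph G) ((`) (conj_class G) ` {rots - center G, refs})"
      "inj_on ((`) (conj_class G)) {rots - center G, refs}" "rots - center G \<notin> {refs}"
    using refs_ne conj_class_refs by (intro clique_union_refs; auto)+
  from *(1) show "clique_union (ccc_graph G) {conj_class G ` (rots - center G), conj_class G ` refs}"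
    by simp
  from *(2,3) show "conj_class G ` (rots - center G) \<noteq> conj_class G ` refs"
    by (auto dest: inj_onD)
  show "2 * card (conj_class G ` (rots - center G)) = (n - 1) * card (center G)"
    by (rule card_rot_classes)
  show "card (conj_class G ` refs) = card (center G)"
  proof -
    have "refs = {x \<in> refs. fst (h x) \<in> {0..<int n}}" using fst_range by (auto simp: refs_def)
    from card_ref_classes[OF order_refl this conj_class_refs] show ?thesis using n_ge by simp
  qed
qed

text \<open>For even \<open>n\<close>, conjugation preserves the parity of the exponent of a
  reflection, and every even difference is a shift by \<open>2 k\<close>. The two parities are
  therefore the two parts.\<close>

lemma ccc_graph_even:
  assumes "even n"
  obtains A B C where "clique_union (ccc_graph G) {A, B, C}" "A \<noteq> B" "A \<noteq> C" "B \<noteq> C"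
    "2 * card A = (n - 1) * card (center G)" "2 * card B = card (center G)" "2 * card C = card (center G)"
proof -
  define R where "R p = {x \<in> refs. fst (h x) \<in> {i \<in> {0..<int n}. even i = p}}" for p
  obtain m where m: "n = 2 * m" using assms by blast
  have R_ne: "R True \<noteq> {}" "R False \<noteq> {}"
  proof -
    obtain x y where "x \<in> carrier G" "h x = (0, True)" "y \<in> carrier G" "h y = (1, True)"
      using h_surj[of 0 True] h_surj[of 1 True] n_ge by auto
    then have "x \<in> R True" "y \<in> R False" using n_ge by (simp_all add: R_def refs_def)
    then show "R True \<noteq> {}" "R False \<noteq> {}" by blast+
  qed
  have closed: "conj_class G x \<subseteq> R p" if "x \<in> R p" for x p
  proof
    fix w assume w: "w \<in> conj_class G x"
    have x: "x \<in> refs" "even (fst (h x)) = p" using that by (simp_all add: R_def)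
    obtain a where a: "a \<in> rots" "w = a \<otimes> x \<otimes> inv a" using w conj_class_ref x by auto
    have "even (fst (h w)) = p"
      using x(2) assms unfolding a fst_conj_ref[OF a(1) x(1)] by (simp add: dvd_mod_iff)
    moreover have "w \<in> refs" using w conj_class_refs x by blast
    ultimately show "w \<in> R p" using fst_range by (auto simp: R_def refs_def)
  qed
  have "\<exists>k. (fst (h x) + 2 * k) mod int n = fst (h y)" if "x \<in> R p" "y \<in> R p" for x y p
  proof
    have "even (fst (h y) - fst (h x))" using that by (auto simp: R_def)
    then show "(fst (h x) + 2 * ((fst (h y) - fst (h x)) div 2)) mod int n = fst (h y)"
      using that by (simp add: R_def)
  qed
  moreover have "\<Union> {R True, R False} = refs" using fst_range by (auto simp: R_def refs_def)
  moreover have "R True \<inter> R False = {}" by (auto simp: R_def)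
  ultimately have *: "clique_union (ccc_graph G) ((`) (conj_class G) ` {rots - center G, R True, R False})"
      "inj_on ((`) (conj_class G)) {rots - center G, R True, R False}" "rots - center G \<notin> {R True, R False}"
    using R_ne closed by (intro clique_union_refs; auto simp: R_def)+
  have "2 * card (conj_class G ` R p) = card (center G)" for p
  proof -
    \<comment> \<open>The exponents of one parity are \<open>2 k\<close> or \<open>2 k + 1\<close>
      for \<open>k < m\<close>, hence half of all.\<close>
    have "{i \<in> {0..<int n}. even i = p} = (\<lambda>k. 2 * k + of_bool (\<not> p)) ` {0..<int m}"
    proof (intro equalityI subsetI)
      fix i assume "i \<in> {i \<in> {0..<int n}. even i = p}"
      then show "i \<in> (\<lambda>k. 2 * k + of_bool (\<not> p)) ` {0..<int m}"
        using m by (intro image_eqI[of _ _ "i div 2"]) auto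
    qed (use m in \<open>auto simp: of_bool_def split: if_splits\<close>)
    then have "card {i \<in> {0..<int n}. even i = p} = m"
      by (simp add: card_image inj_on_def)
    then have "n * card (conj_class G ` R p) = m * card (center G)"
      using card_ref_classes[OF _ R_def closed, of p] by fastforce
    then show ?thesis using m n_ge by simp
  qed
  note card_R = this
  have "R True \<noteq> R False" using R_ne \<open>R True \<inter> R False = {}\<close> by blast
  moreover have "rots - center G \<noteq> R True" "rots - center G \<noteq> R False" using *(3) by simp_all
  moreover have "conj_class G ` S \<noteq> conj_class G ` T"
    if "S \<in> {rots - center G, R True, R False}" "T \<in> {rots - center G, R True, R False}" "S \<noteq> T" for S T
    using inj_on_eq_iff[OF *(2) that(1,2)] that(3) by (simp only: not_False_eq_True)
  ultimately have "conj_class G ` (rots - center G) \<noteq> conj_class G ` R True"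
    "conj_class G ` (rots - center G) \<noteq> conj_class G ` R False"
    "conj_class G ` R True \<noteq> conj_class G ` R False"
    by simp_all
  moreover have "clique_union (ccc_graph G)
      {conj_class G ` (rots - center G), conj_class G ` R True, conj_class G ` R False}"
    using *(1) by simp
  ultimately show ?thesis using card_rot_classes card_R by (intro that)
qed

end

section \<open>Energies of unions of cliques\<close>

text \<open>The contribution of a clique of \<open>m\<close> vertices to the energy: the eigenvalue
  \<open>0\<close> once and \<open>m (m - 2)\<close> with multiplicity \<open>m - 1\<close>. The
  size is real, so that the estimates can treat it as a polynomial variable.\<close>

definition clique_LE :: "real \<Rightarrow> real \<Rightarrow> real" where
  "clique_LE \<Delta> m = \<bar>0 - \<Delta>\<bar> + (m - 1) * \<bar>m * (m - 2) - \<Delta>\<bar>"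

definition clique_LE_plus :: "real \<Rightarrow> real \<Rightarrow> real" where
  "clique_LE_plus \<Delta> m = \<bar>2 * (m - 1) * (m - 2) - \<Delta>\<bar> + (m - 1) * \<bar>(m - 2)\<^sup>2 - \<Delta>\<bar>"

context clique_union
begin

context
  fixes vs
  assumes distinct: "distinct vs" and set_vs: "set vs = pverts g"
begin

private lemma card_clique_pos: "C \<in> \<C> \<Longrightarrow> card C \<ge> 1"
proof -
  assume C: "C \<in> \<C>"
  then have "C \<subseteq> set vs" using set_vs verts by auto
  then have "finite C" by (rule finite_subset) simp
  moreover have "C \<noteq> {}" using C nonempty by metis
  ultimately show ?thesis by (simp add: Suc_le_eq card_gt_0_iff)
qed

private lemma sum_mset_sum: "(\<Sum>x\<in>#(\<Sum>C\<in>I. M C). f x) = (\<Sum>C\<in>I. \<Sum>x\<in>#M C. f x)"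
  for M :: "'c \<Rightarrow> real multiset" and f :: "real \<Rightarrow> real"
  by (induction I rule: infinite_finite_induct) auto

lemma LE_CN_clique_union: "LE_CN g vs = (\<Sum>C\<in>\<C>. clique_LE (CN_Delta g vs) (card C))"
  unfolding LE_CN_def CNL_spec_clique_union[OF distinct set_vs] sum_mset_sum
proof (intro sum.cong refl)
  fix C assume "C \<in> \<C>"
  from card_clique_pos[OF this]
  show "(\<Sum>\<alpha>\<in>#{#0#} + replicate_mset (card C - 1) (real (card C) * (real (card C) - 2)).
      \<bar>\<alpha> - CN_Delta g vs\<bar>) = clique_LE (CN_Delta g vs) (card C)"
    by (simp add: clique_LE_def of_nat_diff)
qed

lemma LE_plus_CN_clique_union: "LE_plus_CN g vs = (\<Sum>C\<in>\<C>. clique_LE_plus (CN_Delta g vs) (card C))"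
  unfolding LE_plus_CN_def CNSL_spec_clique_union[OF distinct set_vs] sum_mset_sum
proof (intro sum.cong refl)
  fix C assume "C \<in> \<C>"
  from card_clique_pos[OF this]
  show "(\<Sum>\<alpha>\<in>#{#2 * (real (card C) - 1) * (real (card C) - 2)#} +
        replicate_mset (card C - 1) ((real (card C) - 2)\<^sup>2). \<bar>\<alpha> - CN_Delta g vs\<bar>) =
      clique_LE_plus (CN_Delta g vs) (card C)"
    by (simp add: clique_LE_plus_def of_nat_diff)
qed

end

end

text \<open>One clique of \<open>a\<close> vertices and \<open>t\<close> cliques of \<open>b\<close> vertices. The disjunction in \<open>b\<close> records
  that \<open>b\<close> is a positive integer as far as needed for \<open>(b - 1) (b - 2) \<ge> 0\<close>.\<close>

locale one_large_clique =
  fixes a b t \<Delta> :: real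
  assumes b: "b = 1 \<or> b \<ge> 2" and t: "0 < t" "t \<le> 2" and a: "2 * b \<le> a"
    and mean: "\<Delta> * (a + t * b) = a * (a - 1) * (a - 2) + t * b * (b - 1) * (b - 2)"
begin

section \<open>Bounds for the mean\<close>

lemma B_nonneg: "0 \<le> (b - 1) * (b - 2)"
  using b by (auto intro: mult_nonneg_nonneg)

lemma A_ge: "(2 * b - 1) * (2 * b - 2) \<le> (a - 1) * (a - 2)"
  using a b by (intro mult_mono) auto

lemma B_le_A: "(b - 1) * (b - 2) \<le> (a - 1) * (a - 2)"
proof -
  \<comment> \<open>This is \<open>(2 b - 1) (2 b - 2) - (b - 1) (b - 2)\<close>.\<close>
  have "0 \<le> (b - 1) * (3 * b)" using b by auto
  then have "(b - 1) * (b - 2) \<le> (2 * b - 1) * (2 * b - 2)" by (simp add: algebra_simps)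
  then show ?thesis using A_ge by simp
qed

lemma weights: "0 < t * b" "t * b \<le> a" "0 < a"
proof -
  show "0 < t * b" using t b by auto
  have "t * b \<le> 2 * b" using t b by (intro mult_right_mono) auto
  then show "t * b \<le> a" using a by simp
  with \<open>0 < t * b\<close> show "0 < a" by simp
qed

lemma Delta_nonneg: "0 \<le> \<Delta>"
proof -
  have "0 \<le> a * ((a - 1) * (a - 2)) + t * b * ((b - 1) * (b - 2))"
    using weights B_nonneg B_le_A by (intro add_nonneg_nonneg mult_nonneg_nonneg[of a] mult_nonneg_nonneg[of "t * b"]) auto
  then have "0 * (a + t * b) \<le> \<Delta> * (a + t * b)" using mean by (simp add: mult.assoc)
  then show ?thesis by (rule mult_right_le_imp_le) (use weights in simp)
qed

lemma Delta_le: "\<Delta> \<le> (a - 1) * (a - 2)"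
proof -
  have "0 \<le> t * b * ((a - 1) * (a - 2) - (b - 1) * (b - 2))"
    using weights B_le_A by (intro mult_nonneg_nonneg[of "t * b"]) auto
  then have "\<Delta> * (a + t * b) \<le> (a - 1) * (a - 2) * (a + t * b)"
    unfolding mean by (simp add: algebra_simps)
  then show ?thesis by (rule mult_right_le_imp_le) (use weights in simp)
qed

text \<open>The large clique has at least half of the total weight, so the mean is at least the
  midpoint of the two values; the larger value is at least what it would be for
  \<open>a = 2 b\<close>.\<close>

lemma Delta_ge: "(b - 1) * (5 * b - 4) \<le> 2 * \<Delta>"
proof -
  have "0 \<le> (a - t * b) * ((a - 1) * (a - 2) - (b - 1) * (b - 2))"
    using weights B_le_A by (intro mult_nonneg_nonneg) auto
  moreover have "2 * \<Delta> * (a + t * b) = 2 * (a * (a - 1) * (a - 2) + t * b * (b - 1) * (b - 2))"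
    using mean by simp
  ultimately have "((a - 1) * (a - 2) + (b - 1) * (b - 2)) * (a + t * b) \<le> 2 * \<Delta> * (a + t * b)"
    by (simp add: algebra_simps)
  then have "(a - 1) * (a - 2) + (b - 1) * (b - 2) \<le> 2 * \<Delta>"
    by (rule mult_right_le_imp_le) (use weights in simp)
  moreover have "(b - 1) * (5 * b - 4) = (2 * b - 1) * (2 * b - 2) + (b - 1) * (b - 2)"
    by (simp add: algebra_simps)
  ultimately show ?thesis using A_ge by linarith
qed

text \<open>The chain \<open>0 \<le> \<Delta> \<le> (a - 1) (a - 2) \<le> a (a - 2)\<close> fixes
  both signs.\<close>

lemma LE_large: "clique_LE \<Delta> a = \<Delta> + (a - 1) * (a * (a - 2) - \<Delta>)"
proof -
  have "(a - 1) * (a - 2) \<le> a * (a - 2)" using a b by (intro mult_right_mono) auto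
  then show ?thesis using Delta_nonneg Delta_le by (simp add: clique_LE_def)
qed

lemma LE_small: "clique_LE \<Delta> b = \<Delta> + (b - 1) * (\<Delta> - b * (b - 2))"
proof -
  \<comment> \<open>This is \<open>(b - 1) (5 b - 4) - 2 b (b - 2)\<close>, so the lower bound for
    \<open>2 \<Delta>\<close> is at least \<open>2 b (b - 2)\<close>.\<close>
  have "0 \<le> (b - 1) * (3 * b - 2) + 2" using b by auto
  then have "2 * (b * (b - 2)) \<le> (b - 1) * (5 * b - 4)" by (simp add: algebra_simps)
  then have "b * (b - 2) \<le> \<Delta>" using Delta_ge by linarith
  then show ?thesis using Delta_nonneg by (simp add: clique_LE_def)
qed

lemma large_signless: "\<Delta> \<le> 2 * (a - 1) * (a - 2)"
proof -
  have "0 \<le> (a - 1) * (a - 2)" using B_nonneg B_le_A by linarith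
  moreover have "2 * (a - 1) * (a - 2) = 2 * ((a - 1) * (a - 2))" by simp
  ultimately show ?thesis using Delta_le by linarith
qed

text \<open>With denominators cleared, the hypothesis says \<open>\<Delta> \<le> (a - 2)^2\<close>,
  the one sign that the assumptions of the locale leave open.\<close>

lemma LE_plus_large:
  assumes "(a - 2) * (a + t * b) \<le> t * b * (a - b) * (a + b - 3)"
  shows "clique_LE_plus \<Delta> a = 2 * (a - 1) * (a - 2) - \<Delta> + (a - 1) * ((a - 2)\<^sup>2 - \<Delta>)"
proof -
  have "\<Delta> * (a + t * b) \<le> (a - 2)\<^sup>2 * (a + t * b)"
    using assms unfolding mean by (simp add: algebra_simps power2_eq_square)
  then have "\<Delta> \<le> (a - 2)\<^sup>2" by (rule mult_right_le_imp_le) (use weights in simp)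
  then show ?thesis using large_signless by (simp add: clique_LE_plus_def)
qed

text \<open>For \<open>b \<ge> 2\<close> the lower bound on the mean gives
  \<open>\<Delta> \<ge> 2 (b - 1) (b - 2) \<ge> (b - 2)^2\<close>. For \<open>b = 1\<close> the
  second term carries the factor \<open>0\<close>.\<close>

lemma LE_plus_small:
  "clique_LE_plus \<Delta> b = \<Delta> - 2 * (b - 1) * (b - 2) + (b - 1) * (\<Delta> - (b - 2)\<^sup>2)"
proof (cases "b = 1")
  case True
  then show ?thesis using Delta_nonneg by (simp add: clique_LE_plus_def)
next
  case False
  then have b2: "b \<ge> 2" using b by simp
  then have "(b - 1) * (4 * (b - 2)) \<le> (b - 1) * (5 * b - 4)" by (intro mult_left_mono) auto
  then have "2 * (b - 1) * (b - 2) \<le> \<Delta>" using Delta_ge by linarith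
  moreover have "(b - 2)\<^sup>2 \<le> 2 * (b - 1) * (b - 2)"
    unfolding power2_eq_square using b2 by (intro mult_right_mono) auto
  ultimately show ?thesis by (simp add: clique_LE_plus_def)
qed

end

text \<open>This serves \<open>n = 3\<close>, where both cliques have the same size and the mean is
  their common diagonal value. The sign of \<open>m - 2\<close> is wrong only at
  \<open>m = 1\<close>, where the factor \<open>m - 1\<close> vanishes.\<close>

lemma clique_LE_eq_sizes:
  assumes "m = 1 \<or> m \<ge> 2" "\<Delta> = (m - 1) * (m - 2)"
  shows "clique_LE \<Delta> m = 2 * (m - 1) * (m - 2)" and "clique_LE_plus \<Delta> m = 2 * (m - 1) * (m - 2)"
proof -
  have "0 \<le> (m - 1) * (m - 2)" using assms(1) by auto
  moreover have "m * (m - 2) - (m - 1) * (m - 2) = m - 2" "2 * (m - 1) * (m - 2) - (m - 1) * (m - 2) = (m - 1) * (m - 2)"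
    "(m - 2)\<^sup>2 - (m - 1) * (m - 2) = - (m - 2)"
    by (simp_all add: algebra_simps power2_eq_square)
  moreover have "(m - 1) * \<bar>m - 2\<bar> = (m - 1) * (m - 2)" using assms(1) by auto
  ultimately show "clique_LE \<Delta> m = 2 * (m - 1) * (m - 2)" "clique_LE_plus \<Delta> m = 2 * (m - 1) * (m - 2)"
    unfolding clique_LE_def clique_LE_plus_def assms(2) by (simp_all only: abs_minus_cancel abs_of_nonneg)
qed

text \<open>Once all signs are known, an energy is affine in the mean; this turns its closed form
  into a polynomial identity with denominators cleared.\<close>

lemma affine_divide_eq:
  fixes p q d e r :: real
  assumes "\<Delta> = e / d" "d \<noteq> 0" "2 * d * p + 2 * q * e = r"
  shows "p + q * \<Delta> = r / (2 * d)"
proof -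
  have "2 * d * (p + q * \<Delta>) = r" using assms by (simp add: algebra_simps)
  then show ?thesis using assms(2) by (simp add: nonzero_eq_divide_eq mult.commute)
qed

lemma LE_two_cliques:
  fixes n z a \<Delta> :: real
  assumes "n \<ge> 5" "z = 1 \<or> z \<ge> 2" and a: "2 * a = (n - 1) * z"
    and \<Delta>: "\<Delta> = (a * (a - 1) * (a - 2) + z * (z - 1) * (z - 2)) / (a + z)"
  shows "clique_LE \<Delta> a + clique_LE \<Delta> z =
      ((n - 1) * z - 2) * ((n - 3) * (n + 1) * z\<^sup>2 + ((n - 6) * n + 17) * z - 4 * (n + 1)) / (2 * (n + 1))"
    and "z = 1 \<Longrightarrow> clique_LE_plus \<Delta> a + clique_LE_plus \<Delta> z = (n - 5) * (n - 3) * (n + 3) / (2 * (n + 1))"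
    and "z \<ge> 2 \<Longrightarrow> clique_LE_plus \<Delta> a + clique_LE_plus \<Delta> z =
      (n - 3) * (n - 1) * z\<^sup>2 * (n * z + z - 6) / (2 * (n + 1))"
proof -
  have "4 * z \<le> (n - 1) * z" using assms by (intro mult_right_mono) auto
  then have a_ge: "2 * z \<le> a" using a by simp
  have size: "2 * (a + z) = (n + 1) * z" using a by (simp add: algebra_simps)
  have a_eq: "a = (n - 1) * z / 2" using a by simp
  have pos: "a + z \<noteq> 0" "n + 1 \<noteq> 0" "z \<noteq> 0" using assms a_ge by auto
  interpret one_large_clique a z 1 \<Delta>
    using assms a_ge pos by unfold_locales (auto simp: \<Delta>)
  \<comment> \<open>The numerator of \<open>\<Delta>\<close> over \<open>n + 1\<close>, after
    cancelling the common factor \<open>z / 2\<close>.\<close>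
  define E where "E = (n - 1) * ((n - 1) * z - 2) * ((n - 1) * z - 4) / 4 + 2 * (z - 1) * (z - 2)"
  have \<Delta>_eq: "\<Delta> = E / (n + 1)"
  proof -
    have "4 * (a * (a - 1) * (a - 2)) = z * ((n - 1) * ((n - 1) * z - 2) * ((n - 1) * z - 4)) / 2"
      unfolding a_eq by (simp add: field_simps)
    then have "a * (a - 1) * (a - 2) + z * (z - 1) * (z - 2) = z * E / 2"
      unfolding E_def by (simp add: field_simps)
    moreover have "a + z = (n + 1) * z / 2" using size by simp
    moreover have "z * E / 2 / ((n + 1) * z / 2) = E / (n + 1)" using pos by simp
    ultimately show ?thesis unfolding \<Delta> by (simp only:)
  qed
  show "clique_LE \<Delta> a + clique_LE \<Delta> z =
      ((n - 1) * z - 2) * ((n - 3) * (n + 1) * z\<^sup>2 + ((n - 6) * n + 17) * z - 4 * (n + 1)) / (2 * (n + 1))"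
  proof -
    have "clique_LE \<Delta> a + clique_LE \<Delta> z =
        (a * (a - 1) * (a - 2) - z * (z - 1) * (z - 2)) + (2 - a + z) * \<Delta>"
      unfolding LE_large LE_small by (simp add: algebra_simps)
    then show ?thesis
      by (simp only:) (rule affine_divide_eq[OF \<Delta>_eq pos(2)],
          simp add: a_eq E_def field_simps power2_eq_square)
  qed
  show "clique_LE_plus \<Delta> a + clique_LE_plus \<Delta> z = (n - 5) * (n - 3) * (n + 3) / (2 * (n + 1))" if "z = 1"
  proof -
    \<comment> \<open>For \<open>z = 1\<close> the open sign is reversed:
      \<open>(\<Delta> - (a - 2)^2) (a + 1) = 2 (a - 2)\<close>.\<close>
    have "0 \<le> 2 * (a - 2)" using a_ge that by simp
    then have "(a - 2)\<^sup>2 * (a + 1) \<le> \<Delta> * (a + 1)"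
      using mean that by (simp add: algebra_simps power2_eq_square)
    then have "(a - 2)\<^sup>2 \<le> \<Delta>" by (rule mult_right_le_imp_le) (use weights in simp)
    then have "clique_LE_plus \<Delta> a = 2 * (a - 1) * (a - 2) - \<Delta> + (a - 1) * (\<Delta> - (a - 2)\<^sup>2)"
      using large_signless by (simp add: clique_LE_plus_def)
    moreover have "clique_LE_plus \<Delta> z = \<Delta>"
      using that Delta_nonneg by (simp add: clique_LE_plus_def)
    ultimately have "clique_LE_plus \<Delta> a + clique_LE_plus \<Delta> z =
        (2 * (a - 1) * (a - 2) - (a - 1) * (a - 2)\<^sup>2) + (a - 1) * \<Delta>"
      by (simp add: algebra_simps)
    then show ?thesis
      by (simp only:) (rule affine_divide_eq[OF \<Delta>_eq pos(2)],
        simp add: that a_eq E_def field_simps power2_eq_square)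
  qed
  show "clique_LE_plus \<Delta> a + clique_LE_plus \<Delta> z =
      (n - 3) * (n - 1) * z\<^sup>2 * (n * z + z - 6) / (2 * (n + 1))" if "z \<ge> 2"
  proof -
    have cond: "(a - 2) * (a + 1 * z) \<le> 1 * z * (a - z) * (a + z - 3)"
    proof -
      \<comment> \<open>In the excesses \<open>s\<close> and \<open>u\<close> over the least
        admissible sizes, the right side minus the left side is a polynomial with nonnegative
        coefficients.\<close>
      define s u where "s = z - 2" "u = a - 2 * z"
      then have "z = 2 + s" "a = 2 * (2 + s) + u" "0 \<le> s" "0 \<le> u" using that a_ge by simp_all
      then show ?thesis by (simp add: algebra_simps)
    qed
    show ?thesis
    proof -
      have "clique_LE_plus \<Delta> a + clique_LE_plus \<Delta> z =
          (a * (a - 1) * (a - 2) - z * (z - 1) * (z - 2)) + (z - a) * \<Delta>"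
        unfolding LE_plus_large[OF cond] LE_plus_small by (simp add: algebra_simps power2_eq_square)
      then show ?thesis
        by (simp only:) (rule affine_divide_eq[OF \<Delta>_eq pos(2)],
          simp add: a_eq E_def field_simps power2_eq_square)
    qed
  qed
qed

lemma LE_three_cliques:
  fixes n z a b \<Delta> :: real
  assumes "n \<ge> 4" "b = 1 \<or> b \<ge> 2" and z: "z = 2 * b" and a_eq: "a = (n - 1) * b"
    and \<Delta>: "\<Delta> = (a * (a - 1) * (a - 2) + 2 * (b * (b - 1) * (b - 2))) / (a + 2 * b)"
  shows "clique_LE \<Delta> a + 2 * clique_LE \<Delta> b =
      ((n - 1) * z - 2) * (n * (z + 1) * ((n - 2) * z - 4) + 11 * z - 4) / (2 * (n + 1))"
    and "n \<ge> 6 \<or> b \<ge> 2 \<Longrightarrow> clique_LE_plus \<Delta> a + 2 * clique_LE_plus \<Delta> b =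
      (n - 2) * (n - 1) * z\<^sup>2 * (n * z - 6) / (2 * (n + 1))"
    and "n = 4 \<Longrightarrow> b = 1 \<Longrightarrow> clique_LE_plus \<Delta> a + 2 * clique_LE_plus \<Delta> b = 28 / 5"
proof -
  have "3 * b \<le> (n - 1) * b" using assms by (intro mult_right_mono) auto
  then have a_ge: "3 * b \<le> a" using a_eq by simp
  have pos: "a + 2 * b \<noteq> 0" "n + 1 \<noteq> 0" "b \<noteq> 0" using assms(1,2) a_ge by auto
  interpret one_large_clique a b 2 \<Delta>
    using assms(1,2) a_ge pos by unfold_locales (auto simp: \<Delta>)
  \<comment> \<open>Again the numerator of \<open>\<Delta>\<close> over \<open>n + 1\<close>; the
    cancelled factor is \<open>b\<close>.\<close>
  define E where "E = (n - 1) * ((n - 1) * b - 1) * ((n - 1) * b - 2) + 2 * (b - 1) * (b - 2)"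
  have \<Delta>_eq: "\<Delta> = E / (n + 1)"
  proof -
    have "a * (a - 1) * (a - 2) + 2 * (b * (b - 1) * (b - 2)) = b * E"
      unfolding E_def a_eq by (simp add: field_simps)
    moreover have "a + 2 * b = (n + 1) * b" using a_eq by (simp add: algebra_simps)
    moreover have "b * E / ((n + 1) * b) = E / (n + 1)" using pos by simp
    ultimately show ?thesis unfolding \<Delta> by (simp only:)
  qed
  show "clique_LE \<Delta> a + 2 * clique_LE \<Delta> b =
      ((n - 1) * z - 2) * (n * (z + 1) * ((n - 2) * z - 4) + 11 * z - 4) / (2 * (n + 1))"
  proof -
    have "clique_LE \<Delta> a + 2 * clique_LE \<Delta> b =
        (a * (a - 1) * (a - 2) - 2 * (b * (b - 1) * (b - 2))) + (2 - a + 2 * b) * \<Delta>"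
      unfolding LE_large LE_small by (simp add: algebra_simps)
    then show ?thesis
      by (simp only:) (rule affine_divide_eq[OF \<Delta>_eq pos(2)],
          simp add: a_eq z E_def field_simps power2_eq_square)
  qed
  show "clique_LE_plus \<Delta> a + 2 * clique_LE_plus \<Delta> b =
      (n - 2) * (n - 1) * z\<^sup>2 * (n * z - 6) / (2 * (n + 1))" if *: "n \<ge> 6 \<or> b \<ge> 2"
  proof -
    have cond: "(a - 2) * (a + 2 * b) \<le> 2 * b * (a - b) * (a + b - 3)"
    proof (cases "b = 1")
      case True
      \<comment> \<open>For \<open>b = 1\<close> the condition is
        \<open>(a - 2) (a - 4) \<ge> 0\<close>. It holds for \<open>n \<ge> 6\<close>, where
        \<open>a = n - 1 \<ge> 5\<close>, and fails for \<open>n = 4\<close>, where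
        \<open>a = 3\<close>.\<close>
      then have "0 \<le> (a - 2) * (a - 4)" using * True a_eq by (intro mult_nonneg_nonneg) auto
      then show ?thesis using True by (simp add: algebra_simps)
    next
      case False
      define s u where "s = b - 2" "u = a - 3 * b"
      then have "b = 2 + s" "a = 3 * (2 + s) + u" "0 \<le> s" "0 \<le> u" using False assms(2) a_ge by simp_all
      then show ?thesis by (simp add: algebra_simps)
    qed
    have "clique_LE_plus \<Delta> a + 2 * clique_LE_plus \<Delta> b =
        (a * (a - 1) * (a - 2) - 2 * (b * (b - 1) * (b - 2))) + (2 * b - a) * \<Delta>"
      unfolding LE_plus_large[OF cond] LE_plus_small by (simp add: algebra_simps power2_eq_square)
    then show ?thesis
      by (simp only:) (rule affine_divide_eq[OF \<Delta>_eq pos(2)],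
        simp add: a_eq z E_def field_simps power2_eq_square)
  qed
  \<comment> \<open>Here \<open>a = 3\<close>, and \<open>\<Delta> = 6/5\<close> exceeds
    \<open>(a - 2)^2 = 1\<close>; the energy is evaluated directly.\<close>
  show "clique_LE_plus \<Delta> a + 2 * clique_LE_plus \<Delta> b = 28 / 5" if "n = 4" "b = 1"
    using that by (simp add: clique_LE_plus_def \<Delta>_eq E_def a_eq)
qed

text \<open>\<open>h\<close> is the projection onto the central quotient followed by the given
  isomorphism, whose injectivity makes the kernel equal to the center.\<close>

lemma (in group) central_dihedralE:
  assumes "finite (carrier G)" "n \<ge> 3" "G Mod center G \<cong> dihedral n"
  obtains h where "central_dihedral G h n"
proof -
  let ?Z = "center G"
  interpret Z: normal ?Z G by (rule center_normal)
  have Q: "group (G Mod ?Z)" by (rule Z.factorgroup_is_group)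
  have D: "group (dihedral n)" using assms(2) by (intro group_dihedral) simp
  obtain f where f: "f \<in> iso (G Mod ?Z) (dihedral n)" using assms(3) by (auto simp: is_iso_def)
  then have f': "f \<in> hom (G Mod ?Z) (dihedral n)" "kernel (G Mod ?Z) (dihedral n) f = {\<one>\<^bsub>G Mod ?Z\<^esub>}"
    "f ` carrier (G Mod ?Z) = carrier (dihedral n)"
    using iso_kernel_image[OF Q D] by auto
  let ?p = "\<lambda>x. ?Z #> x"
  have range_p: "?p ` carrier G = carrier (G Mod ?Z)" by (auto simp: FactGroup_def RCOSETS_def)
  show ?thesis
  proof (rule that[of "f \<circ> ?p"], intro central_dihedral.intro central_dihedral_axioms.intro)
    show "group G" by (rule is_group)
    show "f \<circ> ?p \<in> hom G (dihedral n)" by (rule Group.hom_compose[OF Z.r_coset_hom_Mod f'(1)])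
    show "(f \<circ> ?p) ` carrier G = carrier (dihedral n)" by (simp only: image_comp[symmetric] range_p f'(3))
    have "f (?p x) = \<one>\<^bsub>dihedral n\<^esub> \<longleftrightarrow> x \<in> ?Z" if x: "x \<in> carrier G" for x
    proof -
      have "f (?p x) = \<one>\<^bsub>dihedral n\<^esub> \<longleftrightarrow> ?p x \<in> kernel (G Mod ?Z) (dihedral n) f"
        using x range_p by (auto simp: kernel_def)
      also have "\<dots> \<longleftrightarrow> ?p x = ?Z" unfolding f'(2) by (simp add: FactGroup_def)
      also have "\<dots> \<longleftrightarrow> x \<in> ?Z" using coset_join1 coset_join2 x center_subgroup by metis
      finally show ?thesis .
    qed
    then show "kernel G (dihedral n) (f \<circ> ?p) = ?Z"
      using center_carrier by (auto simp: kernel_def)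
  qed (use assms in simp_all)
qed

section \<open>Spectra and energies for dihedral central quotients\<close>

context central_dihedral
begin

context
  fixes vs :: "'a set list" and z :: nat and rn rz :: real
  assumes vs: "distinct vs" "set vs = pverts (ccc_graph G)"
    and z: "card (center G) = z" and rn: "rn = real n" and rz: "rz = real z"
begin

private lemma z_pos: "z > 0"
  using card_center_pos z by simp

text \<open>Links the clique size \<open>a\<close> to the truncated arithmetic in the stated
  multiplicity and to the real expression in the stated eigenvalues.\<close>

private lemma large_clique:
  assumes "2 * a = (n - 1) * z"
  shows "(n * z - z - 2) div 2 = a - 1" and "2 * real a = (rn - 1) * rz" and "rn * rz - rz = 2 * real a"
proof -
  have "n * z - z = 2 * a" using assms by (simp add: diff_mult_distrib)
  then show "(n * z - z - 2) div 2 = a - 1" by simp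
  have "real (2 * a) = real (n - 1) * real z" using assms by simp
  then show *: "2 * real a = (rn - 1) * rz" using n_ge unfolding rn rz by (simp add: of_nat_diff)
  then show "rn * rz - rz = 2 * real a" by (simp add: algebra_simps)
qed

text \<open>The stated eigenvalues are written in twice the clique size; these equations rewrite
  them in the size \<open>m\<close>.\<close>

private lemma double_eqs:
  "1/4 * (2 * m) * (2 * m - 4) = m * (m - 2)" "1/2 * (2 * m - 2) * (2 * m - 4) = 2 * (m - 1) * (m - 2)"
  "1/4 * (2 * m - 4)\<^sup>2 = (m - 2)\<^sup>2" for m :: real
  by (simp_all add: field_simps power2_eq_square)

lemma odd_spec:
  assumes "odd n"
  shows "CNL_spec (ccc_graph G) vs =
      replicate_mset 2 0
    + replicate_mset ((n * z - z - 2) div 2) (1/4 * (rn*rz - rz) * (rn*rz - rz - 4))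
    + replicate_mset (z - 1) (rz * (rz - 2))"
    and "CNSL_spec (ccc_graph G) vs =
      replicate_mset 1 (1/2 * (rn*rz - rz - 2) * (rn*rz - rz - 4))
    + replicate_mset ((n * z - z - 2) div 2) (1/4 * (rn*rz - rz - 4)^2)
    + replicate_mset 1 (2 * (rz - 1) * (rz - 2))
    + replicate_mset (z - 1) ((rz - 2)^2)"
proof -
  obtain A B where \<C>: "clique_union (ccc_graph G) {A, B}" "A \<noteq> B" and A: "2 * card A = (n - 1) * z"
    and B: "card B = z"
    using ccc_graph_odd[OF assms] z by metis
  interpret clique_union "ccc_graph G" "{A, B}" by (rule \<C>(1))
  show "CNL_spec (ccc_graph G) vs =
      replicate_mset 2 0
    + replicate_mset ((n * z - z - 2) div 2) (1/4 * (rn*rz - rz) * (rn*rz - rz - 4))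
    + replicate_mset (z - 1) (rz * (rz - 2))"
    unfolding CNL_spec_clique_union[OF vs] large_clique(1,3)[OF A] double_eqs
    using \<C>(2) by (simp add: B rz[symmetric] numeral_2_eq_2)
  show "CNSL_spec (ccc_graph G) vs =
      replicate_mset 1 (1/2 * (rn*rz - rz - 2) * (rn*rz - rz - 4))
    + replicate_mset ((n * z - z - 2) div 2) (1/4 * (rn*rz - rz - 4)^2)
    + replicate_mset 1 (2 * (rz - 1) * (rz - 2))
    + replicate_mset (z - 1) ((rz - 2)^2)"
    unfolding CNSL_spec_clique_union[OF vs] large_clique(1,3)[OF A] double_eqs
    using \<C>(2) by (simp add: B rz[symmetric])
qed

private lemma odd_energy:
  assumes "odd n"
  obtains a \<Delta> where "2 * a = (rn - 1) * rz"
    and "\<Delta> = (a * (a - 1) * (a - 2) + rz * (rz - 1) * (rz - 2)) / (a + rz)"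
    and "LE_CN (ccc_graph G) vs = clique_LE \<Delta> a + clique_LE \<Delta> rz"
    and "LE_plus_CN (ccc_graph G) vs = clique_LE_plus \<Delta> a + clique_LE_plus \<Delta> rz"
proof -
  obtain A B where \<C>: "clique_union (ccc_graph G) {A, B}" "A \<noteq> B" and A: "2 * card A = (n - 1) * z"
    and B: "card B = z"
    using ccc_graph_odd[OF assms] z by metis
  interpret clique_union "ccc_graph G" "{A, B}" by (rule \<C>(1))
  show ?thesis
  proof (rule that)
    show "2 * real (card A) = (rn - 1) * rz" by (rule large_clique(2)[OF A])
    show "CN_Delta (ccc_graph G) vs = (real (card A) * (real (card A) - 1) * (real (card A) - 2)
        + rz * (rz - 1) * (rz - 2)) / (real (card A) + rz)"
      using \<C>(2) by (simp add: CN_Delta_clique_union[OF vs] B rz)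
  qed (use \<C>(2) in \<open>simp_all add: LE_CN_clique_union[OF vs] LE_plus_CN_clique_union[OF vs] B rz\<close>)
qed

lemma odd_LE:
  assumes "odd n"
  shows "LE_CN (ccc_graph G) vs =
    (if n = 3 \<and> z = 1 then 0
     else if n = 3 \<and> z \<ge> 2 then 4 * (rz - 1) * (rz - 2)
     else ((rn - 1) * rz - 2)
            * ((rn - 3) * (rn + 1) * rz^2 + ((rn - 6) * rn + 17) * rz - 4 * (rn + 1))
            / (2 * (rn + 1)))"
    and "LE_plus_CN (ccc_graph G) vs =
    (if (n = 3 \<and> z = 1) \<or> (n = 5 \<and> z = 1) then 0
     else if n = 3 \<and> z \<ge> 2 then 4 * (rz - 1) * (rz - 2)
     else if n \<ge> 7 \<and> z = 1 then (rn - 5) * (rn - 3) * (rn + 3) / (2 * (rn + 1))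
     else (rn - 3) * (rn - 1) * rz^2 * (rn*rz + rz - 6) / (2 * (rn + 1)))" (is "_ = ?plus")
proof -
  obtain a \<Delta> where a: "2 * a = (rn - 1) * rz"
    and \<Delta>: "\<Delta> = (a * (a - 1) * (a - 2) + rz * (rz - 1) * (rz - 2)) / (a + rz)"
    and LE: "LE_CN (ccc_graph G) vs = clique_LE \<Delta> a + clique_LE \<Delta> rz"
    and LE_plus: "LE_plus_CN (ccc_graph G) vs = clique_LE_plus \<Delta> a + clique_LE_plus \<Delta> rz"
    using odd_energy[OF assms] by metis
  have z': "rz = 1 \<or> rz \<ge> 2"
  proof -
    have "z = 1 \<or> z \<ge> 2" using z_pos by linarith
    then show ?thesis by (auto simp: rz)
  qed
  have z1: "rz = 1 \<longleftrightarrow> z = 1" and z2: "rz \<ge> 2 \<longleftrightarrow> z \<ge> 2" by (auto simp: rz)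
  \<comment> \<open>The two cases with \<open>n = 3\<close> merge, because
    \<open>4 (z - 1) (z - 2)\<close> vanishes at \<open>z = 1\<close>.\<close>
  have "LE_CN (ccc_graph G) vs =
    (if n = 3 then 4 * (rz - 1) * (rz - 2)
     else ((rn - 1) * rz - 2)
            * ((rn - 3) * (rn + 1) * rz^2 + ((rn - 6) * rn + 17) * rz - 4 * (rn + 1))
            / (2 * (rn + 1)))
    \<and> LE_plus_CN (ccc_graph G) vs = ?plus"
  proof (cases "n = 3")
    case True
    then have "a = rz" using a by (simp add: rn)
    then have "\<Delta> = 2 * rz * ((rz - 1) * (rz - 2)) / (2 * rz)" unfolding \<Delta> by (simp add: mult.assoc)
    then have "\<Delta> = (rz - 1) * (rz - 2)" using z' by auto
    from clique_LE_eq_sizes[OF z' this] show ?thesis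
      using True \<open>a = rz\<close> z' z1 z2 LE LE_plus by auto
  next
    case False
    then have "n \<ge> 5" using n_ge assms by presburger
    then have n5: "rn \<ge> 5" unfolding rn by simp
    note energy = LE_two_cliques[OF n5 z' a \<Delta>]
    have "LE_plus_CN (ccc_graph G) vs = ?plus"
    proof (cases "z = 1")
      case True
      \<comment> \<open>At \<open>n = 5\<close> the factor \<open>rn - 5\<close> yields the listed
        value \<open>0\<close>.\<close>
      moreover have "n = 5 \<or> n \<ge> 7" using \<open>n \<ge> 5\<close> assms by presburger
      ultimately show ?thesis using energy(2) z1 False LE_plus by (auto simp: rn)
    next
      case z_ne: False
      then show ?thesis using energy(3) z' z1 False LE_plus by auto
    qed
    then show ?thesis using False LE energy(1) by simp
  qed
  then show "LE_CN (ccc_graph G) vs =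
    (if n = 3 \<and> z = 1 then 0
     else if n = 3 \<and> z \<ge> 2 then 4 * (rz - 1) * (rz - 2)
     else ((rn - 1) * rz - 2)
            * ((rn - 3) * (rn + 1) * rz^2 + ((rn - 6) * rn + 17) * rz - 4 * (rn + 1))
            / (2 * (rn + 1)))"
    and "LE_plus_CN (ccc_graph G) vs = ?plus"
    using z' z1 z2 by auto
qed

text \<open>The two cliques of \<open>b\<close> vertices contribute the same repeated eigenvalue,
  \<open>b - 1\<close> times each, and \<open>z - 2 = 2 (b - 1)\<close>.\<close>

private lemma small_clique:
  assumes "2 * b = z"
  shows "replicate_mset (z - 2) x = replicate_mset (b - 1) x + replicate_mset (b - 1) x"
    and "rz = 2 * real b"
  using assms by (auto simp: rz multiset_eq_iff)

lemma even_spec: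
  assumes "even n"
  shows "CNL_spec (ccc_graph G) vs =
      replicate_mset 3 0
    + replicate_mset ((n * z - z - 2) div 2) (1/4 * (rn*rz - rz) * (rn*rz - rz - 4))
    + replicate_mset (z - 2) (1/4 * rz * (rz - 4))"
    and "CNSL_spec (ccc_graph G) vs =
      replicate_mset 1 (1/2 * (rn*rz - rz - 2) * (rn*rz - rz - 4))
    + replicate_mset ((n * z - z - 2) div 2) (1/4 * (rn*rz - rz - 4)^2)
    + replicate_mset 2 (1/2 * (rz - 2) * (rz - 4))
    + replicate_mset (z - 2) (1/4 * (rz - 4)^2)"
proof -
  obtain A B C where \<C>: "clique_union (ccc_graph G) {A, B, C}" "A \<noteq> B" "A \<noteq> C" "B \<noteq> C"
    and A: "2 * card A = (n - 1) * z" and B: "2 * card B = z" and C: "2 * card C = z"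
    using ccc_graph_even[OF assms] z by metis
  have BC: "card C = card B" using B C by simp
  interpret clique_union "ccc_graph G" "{A, B, C}" by (rule \<C>(1))
  show "CNL_spec (ccc_graph G) vs =
      replicate_mset 3 0
    + replicate_mset ((n * z - z - 2) div 2) (1/4 * (rn*rz - rz) * (rn*rz - rz - 4))
    + replicate_mset (z - 2) (1/4 * rz * (rz - 4))"
    unfolding CNL_spec_clique_union[OF vs] large_clique(1)[OF A] small_clique(1)[OF B]
      large_clique(3)[OF A]
    unfolding small_clique(2)[OF B] double_eqs
    using \<C>(2-4)
    by (simp add: BC numeral_3_eq_3)
  show "CNSL_spec (ccc_graph G) vs =
      replicate_mset 1 (1/2 * (rn*rz - rz - 2) * (rn*rz - rz - 4))
    + replicate_mset ((n * z - z - 2) div 2) (1/4 * (rn*rz - rz - 4)^2)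
    + replicate_mset 2 (1/2 * (rz - 2) * (rz - 4))
    + replicate_mset (z - 2) (1/4 * (rz - 4)^2)"
    unfolding CNSL_spec_clique_union[OF vs] large_clique(1)[OF A] small_clique(1)[OF B]
      large_clique(3)[OF A]
    unfolding small_clique(2)[OF B] double_eqs
    using \<C>(2-4)
    by (simp add: BC numeral_2_eq_2)
qed

lemma even_LE:
  assumes "even n"
  shows "LE_CN (ccc_graph G) vs =
    ((rn - 1) * rz - 2) * (rn * (rz + 1) * ((rn - 2) * rz - 4) + 11 * rz - 4) / (2 * (rn + 1))"
    and "LE_plus_CN (ccc_graph G) vs =
    (if n = 4 \<and> z = 2 then 28/5
     else if n = 4 \<and> z \<ge> 3 then 3/5 * rz^2 * (4 * rz - 6)
     else (rn - 2) * (rn - 1) * rz^2 * (rn*rz - 6) / (2 * (rn + 1)))"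
proof -
  obtain A B C where \<C>: "clique_union (ccc_graph G) {A, B, C}" "A \<noteq> B" "A \<noteq> C" "B \<noteq> C"
    and A: "2 * card A = (n - 1) * z" and B: "2 * card B = z" and C: "2 * card C = z"
    using ccc_graph_even[OF assms] z by metis
  have BC: "card C = card B" using B C by simp
  interpret clique_union "ccc_graph G" "{A, B, C}" by (rule \<C>(1))
  let ?\<Delta> = "CN_Delta (ccc_graph G) vs"
  define a b where "a = real (card A)" and "b = real (card B)"
  have rz_eq: "rz = 2 * b" using small_clique(2)[OF B] by (simp add: b_def)
  have a: "a = (rn - 1) * b" using large_clique(2)[OF A] by (simp add: rz_eq a_def)
  have b: "b = 1 \<or> b \<ge> 2"
  proof -
    have "card B = 1 \<or> card B \<ge> 2" using z_pos B by linarith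
    then show ?thesis by (auto simp: b_def)
  qed
  have "n \<ge> 4" using n_ge assms by presburger
  then have n4: "rn \<ge> 4" unfolding rn by simp
  have \<Delta>: "?\<Delta> = (a * (a - 1) * (a - 2) + 2 * (b * (b - 1) * (b - 2))) / (a + 2 * b)"
    using \<C>(2-4) by (simp add: CN_Delta_clique_union[OF vs] BC a_def b_def)
  have LE: "LE_CN (ccc_graph G) vs = clique_LE ?\<Delta> a + 2 * clique_LE ?\<Delta> b"
    and LE_plus: "LE_plus_CN (ccc_graph G) vs = clique_LE_plus ?\<Delta> a + 2 * clique_LE_plus ?\<Delta> b"
    using \<C>(2-4)
    by (simp_all add: LE_CN_clique_union[OF vs] LE_plus_CN_clique_union[OF vs] BC a_def b_def)
  note energy = LE_three_cliques[OF n4 b rz_eq a \<Delta>]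
  show "LE_CN (ccc_graph G) vs =
    ((rn - 1) * rz - 2) * (rn * (rz + 1) * ((rn - 2) * rz - 4) + 11 * rz - 4) / (2 * (rn + 1))"
    using LE energy(1) by simp
  show "LE_plus_CN (ccc_graph G) vs =
    (if n = 4 \<and> z = 2 then 28/5
     else if n = 4 \<and> z \<ge> 3 then 3/5 * rz^2 * (4 * rz - 6)
     else (rn - 2) * (rn - 1) * rz^2 * (rn*rz - 6) / (2 * (rn + 1)))"
  proof (cases "n = 4 \<and> z = 2")
    case True
    then have "rn = 4" "b = 1" using rz_eq by (simp_all add: rn rz)
    from energy(3)[OF this] show ?thesis using True LE_plus by simp
  next
    case False
    have "n = 4 \<or> n \<ge> 6" using \<open>n \<ge> 4\<close> assms by presburger
    \<comment> \<open>As \<open>z = 2 b\<close>, excluding \<open>z = 2\<close> for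
      \<open>n = 4\<close> excludes \<open>b = 1\<close>.\<close>
    then have "rn \<ge> 6 \<or> b \<ge> 2" using False b rz_eq by (auto simp: rn rz)
    note main = LE_plus energy(2)[OF this]
    show ?thesis
    proof (cases "n = 4")
      case True
      \<comment> \<open>\<open>z\<close> is even and positive, so \<open>z \<noteq> 2\<close> leaves
        \<open>z \<ge> 3\<close>. At \<open>rn = 4\<close> the general formula simplifies to the
        second listed case.\<close>
      then have "z \<ge> 3" "rn = 4" using False B z_pos by (auto simp: rn)
      then show ?thesis using False True main by simp
    next
      case n_ne: False
      then show ?thesis using main by simp
    qed
  qed
qed

end

end

theorem theorem2p4:
  fixes G :: "('a, 'b) monoid_scheme" and n z :: nat and vs :: "'a set list" and rn rz :: real
  assumes "group G" and "finite (carrier G)"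
    and "card (center G) = z"
    and "n \<ge> 3" and "(G Mod center G) \<cong> dihedral n"
    and "distinct vs" and "set vs = pverts (ccc_graph G)"
  defines "rn \<equiv> real n" and "rz \<equiv> real z"
  shows
    "(even n \<longrightarrow>
        CNL_spec (ccc_graph G) vs =
            replicate_mset 3 0
          + replicate_mset ((n * z - z - 2) div 2) (1/4 * (rn*rz - rz) * (rn*rz - rz - 4))
          + replicate_mset (z - 2) (1/4 * rz * (rz - 4))
      \<and> LE_CN (ccc_graph G) vs =
          ((rn - 1) * rz - 2) * (rn * (rz + 1) * ((rn - 2) * rz - 4) + 11 * rz - 4) / (2 * (rn + 1))
      \<and> CNSL_spec (ccc_graph G) vs =
            replicate_mset 1 (1/2 * (rn*rz - rz - 2) * (rn*rz - rz - 4))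
          + replicate_mset ((n * z - z - 2) div 2) (1/4 * (rn*rz - rz - 4)^2)
          + replicate_mset 2 (1/2 * (rz - 2) * (rz - 4))
          + replicate_mset (z - 2) (1/4 * (rz - 4)^2)
      \<and> LE_plus_CN (ccc_graph G) vs =
          (if n = 4 \<and> z = 2 then 28/5
           else if n = 4 \<and> z \<ge> 3 then 3/5 * rz^2 * (4 * rz - 6)
           else (rn - 2) * (rn - 1) * rz^2 * (rn*rz - 6) / (2 * (rn + 1))))
   \<and> (odd n \<longrightarrow>
        CNL_spec (ccc_graph G) vs =
            replicate_mset 2 0
          + replicate_mset ((n * z - z - 2) div 2) (1/4 * (rn*rz - rz) * (rn*rz - rz - 4))
          + replicate_mset (z - 1) (rz * (rz - 2))
      \<and> LE_CN (ccc_graph G) vs =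
          (if n = 3 \<and> z = 1 then 0
           else if n = 3 \<and> z \<ge> 2 then 4 * (rz - 1) * (rz - 2)
           else ((rn - 1) * rz - 2)
                  * ((rn - 3) * (rn + 1) * rz^2 + ((rn - 6) * rn + 17) * rz - 4 * (rn + 1))
                  / (2 * (rn + 1)))
      \<and> CNSL_spec (ccc_graph G) vs =
            replicate_mset 1 (1/2 * (rn*rz - rz - 2) * (rn*rz - rz - 4))
          + replicate_mset ((n * z - z - 2) div 2) (1/4 * (rn*rz - rz - 4)^2)
          + replicate_mset 1 (2 * (rz - 1) * (rz - 2))
          + replicate_mset (z - 1) ((rz - 2)^2)
      \<and> LE_plus_CN (ccc_graph G) vs =
          (if (n = 3 \<and> z = 1) \<or> (n = 5 \<and> z = 1) then 0
           else if n = 3 \<and> z \<ge> 2 then 4 * (rz - 1) * (rz - 2)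
           else if n \<ge> 7 \<and> z = 1 then (rn - 5) * (rn - 3) * (rn + 3) / (2 * (rn + 1))
           else (rn - 3) * (rn - 1) * rz^2 * (rn*rz + rz - 6) / (2 * (rn + 1))))"
proof -
  obtain h where "central_dihedral G h n"
    using group.central_dihedralE[OF assms(1,2,4,5)] by blast
  then interpret central_dihedral G h n .
  note hyps = assms(6,7,3) rn_def[THEN meta_eq_to_obj_eq] rz_def[THEN meta_eq_to_obj_eq]
  show ?thesis
    using odd_spec[OF hyps] odd_LE[OF hyps] even_spec[OF hyps] even_LE[OF hyps] by blast
qed

end
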